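(* Let $r\in\mathbb N$, $1\le q\le\infty$, and let $k_1,k_2$ be integers and $\alpha$ real with $0\le k_1<\alpha<k_2\le r$. Then $$(\mathbf E,\mathbf E^r)^K_{\alpha/r,q}=(\mathbf E^{k_1},\mathbf E^{k_2})^K_{(\alpha-k_1)/(k_2-k_1),q}$$ as sets, with equivalent norms.
   Context: Let $G=\mathbb R_+\times\mathbb R$ be the "$ax+b$" group with multiplication $(a_1,b_1)(a_2,b_2)=(a_1a_2,\,a_1b_2+b_1)$. Let $T$ be a strongly continuous representation of $G$ in a Banach space $\mathbf E$ with $\|T(g)f\|_{\mathbf E}\le\|f\|_{\mathbf E}$. Put $T_1(t)=T(e^{t},0)$, $T_2(t)=T(1,t)$, with (closed) generators $\mathbb A_1,\mathbb A_2$. For $r\in\mathbb N$, $\mathbf E^{r}$ is the space of $f\in\mathbf E$ for which all products $\mathbb A_{j_1}\cdots\mathbb A_{j_k}f$, $1\le k\le r$, $j_i\in\{1,2\}$, are defined, with norm $\|f\|_{\mathbf E^r}=\|f\|_{\mathbf E}+\sum_{k=1}^r\sum_{(j_1,\dots,j_k)\in\{1,2\}^k}\|\mathbb A_{j_1}\cdots\mathbb A_{j_k}f\|_{\mathbf E}$; $\mathbf E^0=\mathbf E$. For Banach spaces $\mathbf E^{k_2}\subset\mathbf E^{k_1}$, the $K$-functional is $K(t,f,\mathbf E^{k_1},\mathbf E^{k_2})=\inf\{\|f_0\|_{\mathbf E^{k_1}}+t\|f_1\|_{\mathbf E^{k_2}}: f=f_0+f_1\}$, and for $0<\theta<1$,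 $1\le q\le\infty$, the interpolation space $(\mathbf E^{k_1},\mathbf E^{k_2})^K_{\theta,q}$ is the set of $f\in\mathbf E^{k_1}$ with finite norm $\big(\int_0^\infty(t^{-\theta}K(t,f,\mathbf E^{k_1},\mathbf E^{k_2}))^q\frac{dt}{t}\big)^{1/q}$ (with supremum for $q=\infty$). *)

theory Defs
  imports "HOL-Analysis.Analysis"
begin

definition axb_group :: "(real \<times> real) set" where
  "axb_group = {g. fst g > 0}"

definition axb_mult :: "real \<times> real \<Rightarrow> real \<times> real \<Rightarrow> real \<times> real" where
  "axb_mult g1 g2 = (fst g1 * fst g2, fst g1 * snd g2 + snd g1)"

definition contraction_rep :: "(real \<times> real \<Rightarrow> 'a::banach \<Rightarrow> 'a) \<Rightarrow> bool" where
  "contraction_rep T \<longleftrightarrow>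
     (\<forall>g\<in>axb_group. bounded_linear (T g)) \<and>
     T (1, 0) = id \<and>
     (\<forall>g1\<in>axb_group. \<forall>g2\<in>axb_group. T (axb_mult g1 g2) = T g1 \<circ> T g2) \<and>
     (\<forall>f. continuous_on axb_group (\<lambda>g. T g f)) \<and>
     (\<forall>g\<in>axb_group. \<forall>f. norm (T g f) \<le> norm f)"

text \<open>One-parameter groups: False ~ T_1(t) = T(e^t,0), True ~ T_2(t) = T(1,t).\<close>

definition one_param :: "(real \<times> real \<Rightarrow> 'a \<Rightarrow> 'a) \<Rightarrow> bool \<Rightarrow> real \<Rightarrow> 'a \<Rightarrow> 'a" where
  "one_param T j t = (if j then T (1, t) else T (exp t, 0))"

definition has_generator_value ::
  "(real \<times> real \<Rightarrow> 'a::real_normed_vector \<Rightarrow> 'a) \<Rightarrow> bool \<Rightarrow> 'a \<Rightarrow> 'a \<Rightarrow> bool" where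
  "has_generator_value T j f v \<longleftrightarrow>
     ((\<lambda>t. (1 / t) *\<^sub>R (one_param T j t f - f)) \<longlongrightarrow> v) (at_right 0)"

definition generator :: "(real \<times> real \<Rightarrow> 'a::real_normed_vector \<Rightarrow> 'a) \<Rightarrow> bool \<Rightarrow> 'a \<Rightarrow> 'a option" where
  "generator T j f = (if \<exists>v. has_generator_value T j f v
                      then Some (THE v. has_generator_value T j f v) else None)"

fun gen_word :: "(real \<times> real \<Rightarrow> 'a::real_normed_vector \<Rightarrow> 'a) \<Rightarrow> bool list \<Rightarrow> 'a \<Rightarrow> 'a option" where
  "gen_word T [] f = Some f"
| "gen_word T (j # js) f = Option.bind (gen_word T js f) (generator T j)"

definition Ek :: "(real \<times> real \<Rightarrow> 'a::real_normed_vector \<Rightarrow> 'a) \<Rightarrow> nat \<Rightarrow> 'a set" where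
  "Ek T k = {f. \<forall>ws. length ws \<le> k \<longrightarrow> gen_word T ws f \<noteq> None}"

definition Ek_norm :: "(real \<times> real \<Rightarrow> 'a::real_normed_vector \<Rightarrow> 'a) \<Rightarrow> nat \<Rightarrow> 'a \<Rightarrow> real" where
  "Ek_norm T k f = (\<Sum>ws\<in>{ws::bool list. length ws \<le> k}. norm (the (gen_word T ws f)))"

definition K_functional ::
  "(real \<times> real \<Rightarrow> 'a::real_normed_vector \<Rightarrow> 'a) \<Rightarrow> nat \<Rightarrow> nat \<Rightarrow> real \<Rightarrow> 'a \<Rightarrow> real" where
  "K_functional T k1 k2 t f =
     Inf {Ek_norm T k1 f0 + t * Ek_norm T k2 f1 | f0 f1.
            f0 \<in> Ek T k1 \<and> f1 \<in> Ek T k2 \<and> f = f0 + f1}"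

definition interp_norm ::
  "(real \<times> real \<Rightarrow> 'a::real_normed_vector \<Rightarrow> 'a) \<Rightarrow> nat \<Rightarrow> nat \<Rightarrow> real \<Rightarrow> ereal \<Rightarrow> 'a \<Rightarrow> ennreal" where
  "interp_norm T k1 k2 \<theta> q f =
     (if q = \<infinity> then (SUP t\<in>{0<..}. ennreal (t powr (-\<theta>) * K_functional T k1 k2 t f))
      else (let I = (\<integral>\<^sup>+ t. indicator {0<..} t *
                         ennreal ((t powr (-\<theta>) * K_functional T k1 k2 t f) powr (real_of_ereal q) / t) \<partial>lborel)
            in if I = \<infinity> then \<infinity> else ennreal (enn2real I powr (1 / real_of_ereal q))))"

definition interp_space ::
  "(real \<times> real \<Rightarrow> 'a::real_normed_vector \<Rightarrow> 'a) \<Rightarrow> nat \<Rightarrow> nat \<Rightarrow> real \<Rightarrow> ereal \<Rightarrow> 'a set" where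
  "interp_space T k1 k2 \<theta> q = {f \<in> Ek T k1. interp_norm T k1 k2 \<theta> q f < \<infinity>}"

end

(* By reiteration it suffices that every E^k is of class k/r between E and E^r.

   Upper bounds on norms (the J-estimate tau^k N_k(f) <= C (|f| + tau^r N_r(f))) follow from the
   Landau inequality for each one-parameter group: words in the generators
   are handled one letter at a time, so no commutators arise.  Approximation (the K-estimate K(tau^r, f) <= C tau^k N_k(f)) uses the
   average tau^-2 int_0^tau int_0^tau T_1(t) T_2(s) f ds dt, which gains exactly one derivative; the
   relations A_1 T_2(s) = T_2(s) (A_1 + s A_2) and A_2 T_1(t) = e^-t T_1(t) A_2 make it behave like
   a convolution on every E^k.  Going from r to r + 1, the part of the decomposition that stays in
   E^r has half the E^r-norm of f, so the step can be iterated.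

   Near-optimal decompositions at the scales e^(x+n) then telescope, which bounds the K-functional of
   (E^k1, E^k2) by a convolution, with a geometric kernel, of the one of (E, E^r); Jensen's inequality
   turns this into a bound in L^q(dt/t), written in the variable x = ln t. *)

theory Submission
  imports Defs
begin

text \<open>Both couples are read at one common scale \<tau> = e^x, where \<open>E k\<close> carries
  the weight \<tau>^k: the K-functional of (E^k1, E^k2) is taken at \<tau>^(k2 - k1), that of (E,
  E^r) at \<tau>^r. The obstacle is that the operators are contractions on E only. On
  \<open>E k\<close> the relation for A_1 T_2(s) creates a term s A_2, so the bounds there need s
  bounded. Hence the real estimates are proved for \<tau> \<le> 1; for \<tau> > 1 they are trivial,
  since \<open>N k\<close> contains the norm and all lower orders. Norms are unfolded from the
  innermost letter, N_(k+1) f = |f| + N_k (A_1 f) + N_k (A_2 f), so an inequality on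
  \<open>E k\<close> can be applied to A_j f without permuting letters. One average improves the
  error by one order only, and its powers would have to be commuted with the generators. Instead the
  error f - g, small in E^(r-1), is split by the estimate already known for r. That f belongs to
  E^k1 at all is part of the claim; it comes from summing a series in E^k1, which rests on the
  closedness of the generators.\<close>

section \<open>Weighted norms on the line\<close>

text \<open>The tangent of the convex function u^p at u = 1, from which Jensen's inequality is
  derived below. Convexity and the derivative are used on the open half-line, so u = 0 is a case of
  its own.\<close>

lemma powr_above_tangent:
  assumes "p \<ge> 1" "u \<ge> (0::real)"
  shows "1 + p * (u - 1) \<le> u powr p"
proof (cases "u = 0")
  case False
  have "p * (u - 1) \<le> u powr p - 1 powr p"
    by (intro convex_on_imp_above_tangent[where A="{0<..}"] powr_convex assms)
      (use False assms in \<open>auto intro!: derivative_eq_intros simp: interior_open\<close>)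
  then show ?thesis by simp
qed (use assms in simp)

text \<open>Jensen's inequality for the weighted mean \<open>s\<close> of the \<open>a n\<close>:
  the tangent inequality is applied to a n / s and summed against \<open>w\<close>. The bound
  \<open>M\<close> serves summability and does not enter the estimate.\<close>

lemma powr_suminf_le:
  fixes w a :: "nat \<Rightarrow> real"
  assumes w: "\<And>n. 0 \<le> w n" "summable w" "0 < suminf w"
    and a: "\<And>n. 0 \<le> a n" "\<And>n. a n \<le> M" and p: "1 \<le> p"
  shows "summable (\<lambda>n. w n * a n)" "summable (\<lambda>n. w n * a n powr p)"
    "(\<Sum>n. w n * a n) powr p \<le> suminf w powr (p - 1) * (\<Sum>n. w n * a n powr p)"
proof -
  have sM: "summable (\<lambda>n. w n * c)" for c using w(2) by (rule summable_mult2)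
  show s1: "summable (\<lambda>n. w n * a n)"
    by (rule summable_comparison_test'[OF sM[of M]]) (simp add: a w mult_left_mono abs_mult)
  show s2: "summable (\<lambda>n. w n * a n powr p)"
    by (rule summable_comparison_test'[OF sM[of "M powr p"]])
      (use p in \<open>simp add: a w mult_left_mono abs_mult powr_mono2\<close>)
  define s where "s = (\<Sum>n. w n * a n) / suminf w"
  have s0: "0 \<le> s" unfolding s_def using w a s1 by (intro divide_nonneg_pos suminf_nonneg) auto
  show "(\<Sum>n. w n * a n) powr p \<le> suminf w powr (p - 1) * (\<Sum>n. w n * a n powr p)"
  proof (cases "s = 0")
    case True
    then have "(\<Sum>n. w n * a n) = 0" using w(3) by (simp add: s_def)
    moreover have "0 \<le> (\<Sum>n. w n * a n powr p)" using w a s2 by (intro suminf_nonneg) auto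
    ultimately show ?thesis by simp
  next
    case False
    then have s: "s > 0" using s0 by simp
    have eq: "w n * (1 + p * (a n / s - 1)) = (1 - p) * w n + (p / s) * (w n * a n)" for n
      using s by (simp add: field_simps)
    have sp: "summable (\<lambda>n. w n * (a n / s) powr p)"
    proof -
      have "(\<lambda>n. w n * (a n / s) powr p) = (\<lambda>n. (w n * a n powr p) / s powr p)"
        using a s0 by (simp add: powr_divide)
      then show ?thesis using s2 by (simp add: summable_divide)
    qed
    \<comment> \<open>As \<open>s\<close> is the mean, the linear parts of the tangents cancel after
      summation and only the total weight remains.\<close>
    have "suminf w = (1 - p) * suminf w + (p / s) * (\<Sum>n. w n * a n)"
      using s w(3) by (simp add: s_def field_simps)
    also have "\<dots> = (\<Sum>n. (1 - p) * w n + (p / s) * (w n * a n))"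
      by (intro sums_unique sums_add sums_mult summable_sums w s1)
    also have "\<dots> \<le> (\<Sum>n. w n * (a n / s) powr p)"
    proof (rule suminf_le)
      fix n
      show "(1 - p) * w n + (p / s) * (w n * a n) \<le> w n * (a n / s) powr p"
        unfolding eq[symmetric] using a s0 p by (intro mult_left_mono w powr_above_tangent) auto
    qed (use w(2) s1 sp in \<open>auto intro!: summable_add summable_mult\<close>)
    also have "\<dots> = (\<Sum>n. w n * a n powr p) / s powr p"
      using a s0 s2 by (simp add: powr_divide suminf_divide)
    finally have "suminf w * s powr p \<le> (\<Sum>n. w n * a n powr p)"
      using s by (simp add: pos_le_divide_eq)
    then have "suminf w powr (p - 1) * (suminf w * s powr p) \<le> suminf w powr (p - 1) * (\<Sum>n. w n * a n powr p)"
      by (intro mult_left_mono) auto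
    moreover have "suminf w powr (p - 1) * (suminf w * s powr p) = (suminf w * s) powr p"
      using w(3) s0 by (simp add: powr_mult powr_diff)
    moreover have "suminf w * s = (\<Sum>n. w n * a n)" using w(3) by (simp add: s_def)
    ultimately show ?thesis by simp
  qed
qed

text \<open>Jensen holds at every x; integrating in x, each shift \<open>s n\<close> disappears by
  translation invariance, so only the total weight is left.\<close>

lemma nn_integral_powr_convolution:
  fixes F :: "real \<Rightarrow> real" and w s :: "nat \<Rightarrow> real"
  assumes F [measurable]: "F \<in> borel_measurable borel" and F0: "\<And>x. 0 \<le> F x" "\<And>x. F x \<le> M"
    and w: "\<And>n. 0 \<le> w n" "summable w" "0 < suminf w" and p: "1 \<le> p"
  shows "(\<integral>\<^sup>+x. ennreal ((\<Sum>n. w n * F (x + s n)) powr p) \<partial>lborel) \<le>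
    ennreal (suminf w powr p) * (\<integral>\<^sup>+x. ennreal (F x powr p) \<partial>lborel)"
proof -
  note j = powr_suminf_le[OF w, of "\<lambda>n. F (x + s n)" M p for x, OF F0 p]
  have "(\<integral>\<^sup>+x. ennreal ((\<Sum>n. w n * F (x + s n)) powr p) \<partial>lborel) \<le>
      (\<integral>\<^sup>+x. ennreal (suminf w powr (p - 1)) * (\<Sum>n. ennreal (w n) * ennreal (F (x + s n) powr p)) \<partial>lborel)"
  proof (rule nn_integral_mono)
    fix x
    have "(\<Sum>n. ennreal (w n) * ennreal (F (x + s n) powr p)) = ennreal (\<Sum>n. w n * F (x + s n) powr p)"
      using w j(2)[of x] by (simp add: suminf_ennreal2 flip: ennreal_mult'')
    then show "ennreal ((\<Sum>n. w n * F (x + s n)) powr p) \<le>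
        ennreal (suminf w powr (p - 1)) * (\<Sum>n. ennreal (w n) * ennreal (F (x + s n) powr p))"
      using j(3)[of x] by (simp add: ennreal_leI flip: ennreal_mult')
  qed
  also have "\<dots> = ennreal (suminf w powr (p - 1)) * (\<Sum>n. ennreal (w n) * (\<integral>\<^sup>+x. ennreal (F (x + s n) powr p) \<partial>lborel))"
    by (simp add: nn_integral_cmult nn_integral_suminf)
  also have "\<dots> = ennreal (suminf w powr (p - 1)) * (\<Sum>n. ennreal (w n) * (\<integral>\<^sup>+x. ennreal (F x powr p) \<partial>lborel))"
  proof -
    have "(\<integral>\<^sup>+x. ennreal (F (x + s n) powr p) \<partial>lborel) = (\<integral>\<^sup>+x. ennreal (F x powr p) \<partial>lborel)" for n
      using nn_integral_real_affine[of "\<lambda>x. ennreal (F x powr p)" 1 "s n"] by (simp add: add.commute)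
    then show ?thesis by simp
  qed
  also have "\<dots> = ennreal (suminf w powr (p - 1)) * (ennreal (suminf w) * (\<integral>\<^sup>+x. ennreal (F x powr p) \<partial>lborel))"
    using w by (simp add: ennreal_suminf_multc suminf_ennreal2)
  also have "\<dots> = ennreal (suminf w powr p) * (\<integral>\<^sup>+x. ennreal (F x powr p) \<partial>lborel)"
    using w(3) by (simp add: powr_diff flip: ennreal_mult'' mult.assoc)
  finally show ?thesis .
qed

text \<open>Substitution on the compact intervals [-n, n] and their images under exp, followed by
  monotone convergence of the two measures along these exhausting sequences.\<close>

lemma nn_integral_exp_substitution:
  fixes g :: "real \<Rightarrow> ennreal"
  assumes g [measurable]: "g \<in> borel_measurable borel"
  shows "(\<integral>\<^sup>+t. g t * indicator {0<..} t \<partial>lborel) = (\<integral>\<^sup>+x. g (exp x) * ennreal (exp x) \<partial>lborel)"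
proof -
  let ?S = "\<lambda>n. {exp (- real n)..exp (real n)}" and ?R = "\<lambda>n. {- real n..real n}"
  have S: "(\<Union>n. ?S n) = {0<..}"
  proof (intro subset_antisym subsetI)
    fix t :: real assume "t \<in> {0<..}"
    then have t: "t > 0" by simp
    obtain n where n: "\<bar>ln t\<bar> \<le> real n" using real_arch_simple by blast
    then have "exp (- real n) \<le> exp (ln t)" "exp (ln t) \<le> exp (real n)"
      unfolding exp_le_cancel_iff by linarith+
    then have "t \<in> ?S n" using t by simp
    then show "t \<in> (\<Union>n. ?S n)" by blast
  next
    fix t assume "t \<in> (\<Union>n. ?S n)"
    then show "t \<in> {0<..}" by (auto intro: less_le_trans[OF exp_gt_zero])
  qed
  have R: "(\<Union>n. ?R n) = UNIV"
  proof (intro subset_antisym subsetI)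
    fix t :: real
    obtain n where n: "\<bar>t\<bar> \<le> real n" using real_arch_simple by blast
    then show "t \<in> (\<Union>n. ?R n)" by (auto simp: abs_le_iff intro!: exI[of _ n])
  qed auto
  have "(\<integral>\<^sup>+t. g t * indicator {0<..} t \<partial>lborel) = emeasure (density lborel g) (\<Union>n. ?S n)"
    unfolding S by (simp add: emeasure_density)
  also have "\<dots> = (SUP n. emeasure (density lborel g) (?S n))"
    by (intro SUP_emeasure_incseq[symmetric]) (auto simp: incseq_def intro: order_trans)
  also have "\<dots> = (SUP n. emeasure (density lborel (\<lambda>x. g (exp x) * ennreal (exp x))) (?R n))"
  proof (rule SUP_cong[OF refl])
    fix n :: nat
    show "emeasure (density lborel g) (?S n) = emeasure (density lborel (\<lambda>x. g (exp x) * ennreal (exp x))) (?R n)"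
    \<comment> \<open>For n = 0 both intervals are single points, hence null sets; the substitution
      rule handles the nondegenerate ones.\<close>
    proof (cases "n = 0")
      case True
      have "(\<integral>\<^sup>+x. h x * indicator {c..c} x \<partial>lborel) = 0" if [measurable]: "h \<in> borel_measurable borel" for h and c :: real
        by (subst nn_integral_0_iff_AE) (auto intro!: AE_I'[of "{c}"])
      from this[of g 1] this[of "\<lambda>x. g (exp x) * ennreal (exp x)" 0] True show ?thesis by (simp add: emeasure_density)
    next
      case False
      then show ?thesis
        using nn_integral_substitution_aux[of g "- real n" "real n" exp exp, OF g]
        by (simp add: emeasure_density continuous_on_exp continuous_on_id DERIV_exp)
    qed
  qed
  also have "\<dots> = emeasure (density lborel (\<lambda>x. g (exp x) * ennreal (exp x))) (\<Union>n. ?R n)"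
    by (intro SUP_emeasure_incseq) (auto simp: incseq_def)
  also have "\<dots> = (\<integral>\<^sup>+x. g (exp x) * ennreal (exp x) \<partial>lborel)"
    unfolding R by (simp add: emeasure_density)
  finally show ?thesis .
qed

lemma nn_integral_powr_substitution:
  fixes h :: "real \<Rightarrow> real"
  assumes h [measurable]: "h \<in> borel_measurable borel" and m: "0 < m"
  shows "(\<integral>\<^sup>+t. indicator {0<..} t * ennreal (h t / t) \<partial>lborel) = ennreal m * (\<integral>\<^sup>+x. ennreal (h (exp (m * x))) \<partial>lborel)"
proof -
  have "(\<integral>\<^sup>+t. indicator {0<..} t * ennreal (h t / t) \<partial>lborel) = (\<integral>\<^sup>+x. ennreal (h (exp x) / exp x) * ennreal (exp x) \<partial>lborel)"
    using nn_integral_exp_substitution[of "\<lambda>t. ennreal (h t / t)"] by (simp add: mult.commute)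
  also have "\<dots> = (\<integral>\<^sup>+x. ennreal (h (exp x)) \<partial>lborel)"
    by (simp flip: ennreal_mult'')
  also have "\<dots> = ennreal m * (\<integral>\<^sup>+x. ennreal (h (exp (m * x))) \<partial>lborel)"
    using nn_integral_real_affine[of "\<lambda>x. ennreal (h (exp x))" m 0] m by simp
  finally show ?thesis .
qed

text \<open>The p-th root exactly as it occurs in \<open>interp_norm\<close>. Infinity is separate
  because \<open>enn2real\<close> sends it to 0.\<close>

definition ennroot :: "real \<Rightarrow> ennreal \<Rightarrow> ennreal" where
  "ennroot p I = (if I = \<infinity> then \<infinity> else ennreal (enn2real I powr (1 / p)))"

lemma ennroot_le:
  assumes "I \<le> ennreal c * J" "0 < c" "0 < p"
  shows "ennroot p I \<le> ennreal (c powr (1 / p)) * ennroot p J"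
proof (cases "J = \<infinity>")
  case True
  then show ?thesis using assms by (simp add: ennroot_def ennreal_mult_top)
next
  case False
  then obtain b where b: "J = ennreal b" "0 \<le> b" by (cases J) auto
  then have I: "I \<le> ennreal (c * b)" using assms by (simp add: ennreal_mult')
  then obtain a where a: "I = ennreal a" "0 \<le> a" by (cases I) (auto simp: top_unique)
  then have "a \<le> c * b" using I assms b by simp
  then have "a powr (1 / p) \<le> c powr (1 / p) * b powr (1 / p)"
    using a b assms by (subst powr_mult[symmetric]) (auto intro!: powr_mono2)
  then show ?thesis using a b by (simp add: ennroot_def ennreal_leI flip: ennreal_mult')
qed

lemma ennroot_less_top_iff: "ennroot p I < \<infinity> \<longleftrightarrow> I < \<infinity>"
  by (auto simp: ennroot_def less_top)

text \<open>The factor \<open>m\<close> is the Jacobian of t = exp (m * x), for which dt/t = m dx.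
  Keeping it makes the interpolation norm equal to this norm, not merely equivalent.\<close>

definition Lq_norm :: "real \<Rightarrow> ereal \<Rightarrow> (real \<Rightarrow> real) \<Rightarrow> ennreal" where
  "Lq_norm m q F = (if q = \<infinity> then (SUP x. ennreal (F x))
     else ennroot (real_of_ereal q) (ennreal m * (\<integral>\<^sup>+x. ennreal (F x powr real_of_ereal q) \<partial>lborel)))"

text \<open>Two one-sided geometric kernels, one for each direction of telescoping. \<open>C\<close>
  is fixed before \<open>F\<close>, \<open>G\<close> and \<open>M\<close>: boundedness of
  \<open>F\<close> makes the series converge, but its size does not influence the constant.\<close>

lemma Lq_norm_convolution_le:
  assumes m: "0 < m" "0 < m'" and q: "1 \<le> q" and c: "0 < c" and w: "0 < w" "w < 1"
  obtains C where "0 < C"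
    "\<And>F G M. F \<in> borel_measurable borel \<Longrightarrow> (\<And>x. 0 \<le> F x) \<Longrightarrow> (\<And>x. F x \<le> M) \<Longrightarrow> (\<And>x. 0 \<le> G x) \<Longrightarrow>
       (\<And>x. G x \<le> c * ((\<Sum>n. w ^ n * F (x + (- real n))) + (\<Sum>n. w ^ n * F (x + real n)))) \<Longrightarrow>
       Lq_norm m' q G \<le> ennreal C * Lq_norm m q F"
proof -
  have w': "\<And>n. 0 \<le> w ^ n" "summable (\<lambda>n. w ^ n)" and W: "0 < (\<Sum>n. w ^ n)"
    using w by (auto simp: summable_geometric suminf_geometric)
  define W where "W = (\<Sum>n. w ^ n)"
  note W = W[folded W_def]
  show ?thesis
  proof (cases "q = \<infinity>")
    case True
    show ?thesis
    proof (rule that[of "c * (2 * W)"])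
      show "0 < c * (2 * W)" using c W by simp
      fix F G :: "real \<Rightarrow> real" and M
      assume F: "F \<in> borel_measurable borel" "\<And>x. 0 \<le> F x" "\<And>x. F x \<le> M"
        and G: "\<And>x. 0 \<le> G x"
          "\<And>x. G x \<le> c * ((\<Sum>n. w ^ n * F (x + (- real n))) + (\<Sum>n. w ^ n * F (x + real n)))"
      define S where "S = (SUP x. F x)"
      have bdd: "bdd_above (range F)" using F(3) by (auto intro: bdd_aboveI2[of UNIV F M])
      have FS: "F x \<le> S" for x unfolding S_def by (rule cSUP_upper[OF _ bdd]) simp
      have S0: "0 \<le> S" using F(2)[of 0] FS[of 0] by simp
      have 1: "(\<Sum>n. w ^ n * F (x + s n)) \<le> W * S" for x and s :: "nat \<Rightarrow> real"
      proof -
        have "summable (\<lambda>n. w ^ n * S)" by (rule summable_mult2[OF w'(2)])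
        moreover have "summable (\<lambda>n. w ^ n * F (x + s n))"
          using powr_suminf_le(1)[OF w' W[unfolded W_def], of "\<lambda>n. F (x + s n)" M 1] F by auto
        ultimately have "(\<Sum>n. w ^ n * F (x + s n)) \<le> (\<Sum>n. w ^ n * S)"
          by (intro suminf_le mult_left_mono FS w')
        then show ?thesis unfolding W_def by (simp add: suminf_mult2[OF w'(2)])
      qed
      have "G x \<le> c * (2 * W) * S" for x
      proof -
        note G(2)
        also have "c * ((\<Sum>n. w ^ n * F (x + (- real n))) + (\<Sum>n. w ^ n * F (x + real n))) \<le> c * (W * S + W * S)"
          using c by (intro mult_left_mono add_mono 1) auto
        finally show ?thesis by (simp add: algebra_simps)
      qed
      then have "(SUP x. ennreal (G x)) \<le> ennreal (c * (2 * W)) * ennreal S"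
        using c W S0 by (intro SUP_least) (auto simp: ennreal_leI simp flip: ennreal_mult)
      moreover have "ennreal S \<le> (SUP x. ennreal (F x))"
      proof (rule ccontr)
        assume "\<not> ?thesis"
        then have "(SUP x. ennreal (F x)) < ennreal S" by simp
        moreover from this obtain b where b: "(SUP x. ennreal (F x)) = ennreal b" "0 \<le> b"
          by (cases "(SUP x. ennreal (F x))") auto
        moreover have "ennreal (F x) \<le> (SUP x. ennreal (F x))" for x by (rule SUP_upper) simp
        ultimately have "b < S" "\<And>x. F x \<le> b" by (auto simp: ennreal_less_iff)
        then show False unfolding S_def using cSUP_least[of UNIV F b] by auto
      qed
      ultimately have "(SUP x. ennreal (G x)) \<le> ennreal (c * (2 * W)) * (SUP x. ennreal (F x))"
        by (meson mult_left_mono order_trans zero_le)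
      then show "Lq_norm m' q G \<le> ennreal (c * (2 * W)) * Lq_norm m q F"
        using True by (simp add: Lq_norm_def)
    qed
  next
    case False
    define p where "p = real_of_ereal q"
    have p: "1 \<le> p" using q False by (cases q) (auto simp: p_def)
    \<comment> \<open>2^p comes from separating the two kernels by their maximum, and 2 W^p from one
      convolution bound for each of them.\<close>
    define D where "D = c powr p * (2 powr p * (2 * W powr p))"
    have D: "0 < D" unfolding D_def using c W by (intro mult_pos_pos) auto
    define C where "C = (D * m' / m) powr (1 / p)"
    show ?thesis
    proof (rule that[of C])
      show "0 < C" using D m by (auto simp: C_def)
      fix F G :: "real \<Rightarrow> real" and M
      assume F [measurable]: "F \<in> borel_measurable borel" and F0: "\<And>x. 0 \<le> F x" "\<And>x. F x \<le> M"
        and G: "\<And>x. 0 \<le> G x"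
          "\<And>x. G x \<le> c * ((\<Sum>n. w ^ n * F (x + (- real n))) + (\<Sum>n. w ^ n * F (x + real n)))"
      define S where "S s x = (\<Sum>n. w ^ n * F (x + s n))" for s :: "nat \<Rightarrow> real" and x
      have S0: "0 \<le> S s x" for s x unfolding S_def
        using powr_suminf_le(1)[OF w' W[unfolded W_def], of "\<lambda>n. F (x + s n)" M 1] F0 w'
        by (intro suminf_nonneg) auto
      have [measurable]: "S s \<in> borel_measurable borel" for s unfolding S_def by measurable
      let ?I = "\<lambda>F. \<integral>\<^sup>+x. ennreal (F x powr p) \<partial>lborel"
      have "?I G \<le> (\<integral>\<^sup>+x. ennreal (c powr p * 2 powr p) * (ennreal (S (\<lambda>n. - real n) x powr p) + ennreal (S real x powr p)) \<partial>lborel)"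
      proof (rule nn_integral_mono)
        fix x
        let ?a = "S (\<lambda>n. - real n) x" and ?b = "S real x"
        have "G x \<le> c * (?a + ?b)" unfolding S_def by (rule G(2))
        also have "\<dots> \<le> c * (2 * max ?a ?b)" using c by (intro mult_left_mono) auto
        finally have "G x powr p \<le> (c * (2 * max ?a ?b)) powr p"
          using G(1) p by (intro powr_mono2) auto
        also have "\<dots> = c powr p * 2 powr p * (max ?a ?b) powr p"
          using c S0 by (simp add: powr_mult le_max_iff_disj)
        also have "(max ?a ?b) powr p \<le> ?a powr p + ?b powr p"
          by (auto simp: max_def)
        finally have "G x powr p \<le> c powr p * 2 powr p * (?a powr p + ?b powr p)"
          by (simp add: mult_left_mono)
        then show "ennreal (G x powr p) \<le> ennreal (c powr p * 2 powr p) * (ennreal (?a powr p) + ennreal (?b powr p))"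
          by (simp add: ennreal_leI flip: ennreal_mult ennreal_plus)
      qed
      also have "\<dots> = ennreal (c powr p * 2 powr p) * (?I (S (\<lambda>n. - real n)) + ?I (S real))"
        by (simp add: nn_integral_cmult nn_integral_add)
      also have "\<dots> \<le> ennreal (c powr p * 2 powr p) * (ennreal (W powr p) * ?I F + ennreal (W powr p) * ?I F)"
        unfolding S_def W_def using W
        by (intro mult_left_mono add_mono nn_integral_powr_convolution[where M=M] F F0 w' p) (auto simp: W_def)
      also have "\<dots> = ennreal D * ?I F"
      proof -
        have "ennreal D = ennreal (c powr p * 2 powr p) * (ennreal (W powr p) + ennreal (W powr p))"
          by (simp add: D_def algebra_simps flip: ennreal_mult ennreal_plus)
        then show ?thesis by (simp add: distrib_right mult.assoc)
      qed
      finally have "ennreal m' * ?I G \<le> ennreal m' * (ennreal D * ?I F)"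
        by (intro mult_left_mono) auto
      also have "\<dots> = ennreal (D * m' / m) * (ennreal m * ?I F)"
      proof -
        have "ennreal m' * ennreal D = ennreal (D * m' / m) * ennreal m"
          using D m by (simp add: mult.commute flip: ennreal_mult)
        then show ?thesis by (simp flip: mult.assoc)
      qed
      finally show "Lq_norm m' q G \<le> ennreal C * Lq_norm m q F"
        using False p D m unfolding C_def by (auto simp: Lq_norm_def p_def[symmetric] intro!: ennroot_le)
    qed
  qed
qed

lemma Lq_norm_mono_const:
  assumes m: "0 < m" "0 < m'" and q: "1 \<le> q" and c: "0 < c"
  obtains C where "0 < C"
    "\<And>F G. F \<in> borel_measurable borel \<Longrightarrow> (\<And>x. 0 \<le> F x) \<Longrightarrow> (\<And>x. 0 \<le> G x) \<Longrightarrow>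
       (\<And>x. G x \<le> c * F x) \<Longrightarrow> Lq_norm m' q G \<le> ennreal C * Lq_norm m q F"
proof (cases "q = \<infinity>")
  case True
  show ?thesis
  proof (rule that[OF c])
    fix F G :: "real \<Rightarrow> real" assume "\<And>x. 0 \<le> F x" and G: "\<And>x. G x \<le> c * F x"
    have "ennreal (G x) \<le> ennreal c * (SUP x. ennreal (F x))" for x
    proof -
      have "ennreal (G x) \<le> ennreal c * ennreal (F x)"
        using G[of x] c by (simp add: ennreal_leI flip: ennreal_mult')
      also have "\<dots> \<le> ennreal c * (SUP x. ennreal (F x))"
        by (intro mult_left_mono SUP_upper) auto
      finally show ?thesis .
    qed
    then show "Lq_norm m' q G \<le> ennreal c * Lq_norm m q F"
      using True by (auto simp: Lq_norm_def intro: SUP_least)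
  qed
next
  case False
  define p where "p = real_of_ereal q"
  have p: "1 \<le> p" using q False by (cases q) (auto simp: p_def)
  show ?thesis
  proof (rule that[of "(c powr p * m' / m) powr (1 / p)"])
    show "0 < (c powr p * m' / m) powr (1 / p)" using c m by simp
    fix F G :: "real \<Rightarrow> real"
    assume F [measurable]: "F \<in> borel_measurable borel" and F0: "\<And>x. 0 \<le> F x" and G0: "\<And>x. 0 \<le> G x"
      and G: "\<And>x. G x \<le> c * F x"
    let ?I = "\<lambda>F. \<integral>\<^sup>+x. ennreal (F x powr p) \<partial>lborel"
    have "?I G \<le> (\<integral>\<^sup>+x. ennreal (c powr p) * ennreal (F x powr p) \<partial>lborel)"
    proof (rule nn_integral_mono)
      fix x
      have "G x powr p \<le> (c * F x) powr p" using p G0 G by (intro powr_mono2) auto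
      then show "ennreal (G x powr p) \<le> ennreal (c powr p) * ennreal (F x powr p)"
        using c F0 by (simp add: powr_mult ennreal_leI flip: ennreal_mult')
    qed
    also have "\<dots> = ennreal (c powr p) * ?I F" by (simp add: nn_integral_cmult)
    finally have "ennreal m' * ?I G \<le> ennreal m' * (ennreal (c powr p) * ?I F)"
      by (intro mult_left_mono) auto
    also have "\<dots> = ennreal (c powr p * m' / m) * (ennreal m * ?I F)"
    proof -
      have "ennreal m' * ennreal (c powr p) = ennreal (c powr p * m' / m) * ennreal m"
        using m by (simp add: mult.commute flip: ennreal_mult)
      then show ?thesis by (simp flip: mult.assoc)
    qed
    finally show "Lq_norm m' q G \<le> ennreal ((c powr p * m' / m) powr (1 / p)) * Lq_norm m q F"
      using False p c m by (auto simp: Lq_norm_def p_def[symmetric] intro!: ennroot_le)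
  qed
qed

section \<open>The one-parameter groups and their generators\<close>

lemma has_vector_derivative_at_iff_quotient:
  "(f has_vector_derivative v) (at x) \<longleftrightarrow> ((\<lambda>h. (1 / h) *\<^sub>R (f (x + h) - f x)) \<longlongrightarrow> v) (at (0::real))"
proof -
  have "(f has_vector_derivative v) (at x) \<longleftrightarrow>
      ((\<lambda>h. norm (f (x + h) - f x - h *\<^sub>R v) / norm h) \<longlongrightarrow> 0) (at 0)"
    unfolding has_vector_derivative_def has_derivative_at
    by (simp add: bounded_linear_scaleR_left)
  also have "\<dots> \<longleftrightarrow> ((\<lambda>h. norm ((1 / h) *\<^sub>R (f (x + h) - f x) - v)) \<longlongrightarrow> 0) (at 0)"
  proof (rule filterlim_cong[OF refl refl], rule eventually_at_filter[THEN iffD2], rule always_eventually, safe)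
    fix h :: real assume "h \<noteq> 0"
    then have "(1 / h) *\<^sub>R (f (x + h) - f x) - v = (1 / h) *\<^sub>R (f (x + h) - f x - h *\<^sub>R v)"
      by (simp add: scaleR_diff_right)
    then show "norm (f (x + h) - f x - h *\<^sub>R v) / norm h = norm ((1 / h) *\<^sub>R (f (x + h) - f x) - v)"
      by simp
  qed
  also have "\<dots> \<longleftrightarrow> ((\<lambda>h. (1 / h) *\<^sub>R (f (x + h) - f x)) \<longlongrightarrow> v) (at 0)"
    by (subst tendsto_norm_zero_iff) (rule LIM_zero_iff)
  finally show ?thesis .
qed

locale axb_rep =
  fixes T :: "real \<times> real \<Rightarrow> 'a::banach \<Rightarrow> 'a"
  assumes rep: "contraction_rep T"
begin

abbreviation "U \<equiv> one_param T"
abbreviation "gen \<equiv> has_generator_value T"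

lemma T_mult: "fst g > 0 \<Longrightarrow> fst h > 0 \<Longrightarrow> T g (T h f) = T (axb_mult g h) f"
  using rep unfolding contraction_rep_def axb_group_def
  by (metis (mono_tags, lifting) comp_apply mem_Collect_eq)

lemma U_bounded_linear: "bounded_linear (U j t)"
  using rep by (auto simp: contraction_rep_def one_param_def axb_group_def)

lemmas U_add_vec = bounded_linear.linear[OF U_bounded_linear, THEN linear_add]
lemmas U_diff_vec = bounded_linear.linear[OF U_bounded_linear, THEN linear_diff]
lemmas U_scaleR = bounded_linear.linear[OF U_bounded_linear, THEN linear_scale]

lemma U_0 [simp]: "U j 0 f = f"
  using rep by (auto simp: contraction_rep_def one_param_def)

lemma U_add: "U j (s + t) f = U j s (U j t f)"
  by (auto simp: one_param_def T_mult axb_mult_def exp_add add.commute)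

lemma U_norm: "norm (U j t f) \<le> norm f"
  using rep by (auto simp: contraction_rep_def one_param_def axb_group_def)

text \<open>Both sides are T at the group element (exp t, exp t * s). This is the only mixed
  relation between the two subgroups that is needed; differentiating it gives the rules for moving a
  generator past the other group.\<close>

lemma U_False_True: "U False t (U True s f) = U True (exp t * s) (U False t f)"
  by (auto simp: one_param_def T_mult axb_mult_def)

lemma U_True_False: "U True s (U False t f) = U False t (U True (exp (- t) * s) f)"
  by (simp add: U_False_True flip: mult.assoc exp_add)

lemma U_continuous: "continuous_on UNIV (\<lambda>t. U j t f)"
proof -
  have c: "continuous_on axb_group (\<lambda>g. T g f)"
    using rep by (auto simp: contraction_rep_def)
  show ?thesis
    by (cases j) (auto simp: one_param_def axb_group_def
        intro!: continuous_on_compose2[OF c] continuous_intros)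
qed

text \<open>Strong continuity is continuity in t for a fixed vector. Contractivity makes it joint in
  both arguments, since the change of the vector is not enlarged.\<close>

lemma tendsto_U:
  assumes t: "(t \<longlongrightarrow> t0) F" and u: "(u \<longlongrightarrow> u0) F"
  shows "((\<lambda>x. U j (t x) (u x)) \<longlongrightarrow> U j t0 u0) F"
proof -
  have "isCont (\<lambda>t. U j t u0) t0"
    using U_continuous continuous_on_eq_continuous_at by blast
  then have 1: "((\<lambda>x. U j (t x) u0) \<longlongrightarrow> U j t0 u0) F"
    using t by (rule isCont_tendsto_compose)
  have 2: "((\<lambda>x. U j (t x) (u x - u0)) \<longlongrightarrow> 0) F"
  proof (rule Lim_null_comparison)
    show "((\<lambda>x. norm (u x - u0)) \<longlongrightarrow> 0) F"
      using u by (simp add: LIM_zero tendsto_norm_zero)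
  qed (auto intro!: always_eventually U_norm)
  have "((\<lambda>x. U j (t x) u0 + U j (t x) (u x - u0)) \<longlongrightarrow> U j t0 u0 + 0) F"
    by (rule tendsto_add[OF 1 2])
  then show ?thesis by (simp add: U_diff_vec)
qed

lemma continuous_on_U [continuous_intros]:
  "continuous_on S t \<Longrightarrow> continuous_on S u \<Longrightarrow> continuous_on S (\<lambda>x. U j (t x) (u x))"
  by (auto simp: continuous_on_def intro: tendsto_U)

text \<open>The generator is defined by a right-hand limit. Applying U j (-t) to the right quotient
  at t turns it into the left quotient at -t, so the group property gives the two-sided
  derivative.\<close>

lemma gen_iff_derivative:
  "gen j f v \<longleftrightarrow> ((\<lambda>t. U j t f) has_vector_derivative v) (at 0)"
proof
  assume "((\<lambda>t. U j t f) has_vector_derivative v) (at 0)"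
  then show "gen j f v"
    by (auto simp: has_vector_derivative_at_iff_quotient has_generator_value_def intro: filterlim_mono at_le)
next
  assume "gen j f v"
  then have r: "((\<lambda>t. (1 / t) *\<^sub>R (U j t f - f)) \<longlongrightarrow> v) (at_right 0)"
    by (simp add: has_generator_value_def)
  have l: "((\<lambda>t. (1 / t) *\<^sub>R (U j t f - f)) \<longlongrightarrow> v) (at_left 0)"
  proof -
    have "((\<lambda>t. U j (- t) ((1 / t) *\<^sub>R (U j t f - f))) \<longlongrightarrow> U j 0 v) (at_right 0)"
      by (intro tendsto_U r tendsto_eq_intros) auto
    moreover have "U j (- t) ((1 / t) *\<^sub>R (U j t f - f)) = (1 / - t) *\<^sub>R (U j (- t) f - f)" for t
      using U_add[of j "- t" t f] by (simp add: U_scaleR U_diff_vec scaleR_diff_right)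
    ultimately show ?thesis
      by (simp add: at_left_minus[of 0] filterlim_filtermap)
  qed
  from l r show "((\<lambda>t. U j t f) has_vector_derivative v) (at 0)"
    by (simp add: has_vector_derivative_at_iff_quotient filterlim_split_at)
qed

lemma gen_derivative:
  assumes "gen j f v"
  shows "((\<lambda>t. U j t f) has_vector_derivative U j t v) (at t within S)"
proof -
  have "((\<lambda>h. (1 / h) *\<^sub>R (U j h f - f)) \<longlongrightarrow> v) (at 0)"
    using assms by (simp add: gen_iff_derivative has_vector_derivative_at_iff_quotient)
  then have "((\<lambda>h. U j t ((1 / h) *\<^sub>R (U j h f - f))) \<longlongrightarrow> U j t v) (at 0)"
    by (intro tendsto_U tendsto_const)
  then have "((\<lambda>t. U j t f) has_vector_derivative U j t v) (at t)"
    by (simp add: has_vector_derivative_at_iff_quotient U_scaleR U_diff_vec U_add)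
  then show ?thesis by (rule has_vector_derivative_at_within)
qed

lemma gen_unique: "gen j f v \<Longrightarrow> gen j f w \<Longrightarrow> v = w"
  unfolding has_generator_value_def by (rule tendsto_unique[rotated]) auto

lemma gen_add: "gen j f v \<Longrightarrow> gen j g w \<Longrightarrow> gen j (f + g) (v + w)"
  unfolding gen_iff_derivative U_add_vec by (rule has_vector_derivative_add)

lemma gen_scaleR: "gen j f v \<Longrightarrow> gen j (c *\<^sub>R f) (c *\<^sub>R v)"
  unfolding gen_iff_derivative U_scaleR
  by (rule bounded_linear.has_vector_derivative[OF bounded_linear_scaleR_right])

lemma gen_U: "gen j f v \<Longrightarrow> gen j (U j t f) (U j t v)"
  unfolding gen_iff_derivative
  using bounded_linear.has_vector_derivative[OF U_bounded_linear, of "\<lambda>s. U j s f" v "at 0" j t]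
  by (simp flip: U_add add: add.commute)

text \<open>Passing U True s through U False t rescales s by exp (-t); the chain rule at s = 0
  produces this factor.\<close>

lemma gen_True_U_False:
  assumes "gen True f v"
  shows "gen True (U False t f) (exp (- t) *\<^sub>R U False t v)"
proof -
  have "((\<lambda>s. s * exp (- t)) has_vector_derivative exp (- t)) (at 0)"
    by (auto intro!: derivative_eq_intros simp flip: has_real_derivative_iff_has_vector_derivative)
  from vector_derivative_diff_chain_within[OF this, where g="\<lambda>s. U True s f" and g'="\<lambda>x. x *\<^sub>R v"]
  have "((\<lambda>s. U True (s * exp (- t)) f) has_vector_derivative exp (- t) *\<^sub>R v) (at 0)"
    using assms gen_derivative[OF assms, of 0] by (simp add: o_def has_vector_derivative_def)
  from bounded_linear.has_vector_derivative[OF U_bounded_linear this, of False t]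
  show ?thesis
    by (simp add: gen_iff_derivative U_True_False mult.commute U_scaleR)
qed

text \<open>A product rule: in U True (exp h * s) (U False h f) the quotient splits into one part
  acting on U False h f - f, giving \<open>v\<close>, and one in which only the parameter exp h * s
  moves, giving the extra term with \<open>w\<close>.\<close>

lemma gen_False_U_True:
  assumes "gen False f v" "gen True f w"
  shows "gen False (U True s f) (U True s v + s *\<^sub>R U True s w)"
proof -
  have "((\<lambda>h. exp h * s) has_vector_derivative s) (at 0)"
    by (auto intro!: derivative_eq_intros simp flip: has_real_derivative_iff_has_vector_derivative)
  from vector_derivative_diff_chain_within[OF this, where g="\<lambda>s. U True s f" and g'="\<lambda>x. x *\<^sub>R U True s w"]
  have "((\<lambda>h. U True (exp h * s) f) has_vector_derivative s *\<^sub>R U True s w) (at 0)"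
    using gen_derivative[OF assms(2), of s] by (simp add: o_def has_vector_derivative_def)
  then have 2: "((\<lambda>h. (1 / h) *\<^sub>R (U True (exp h * s) f - U True s f)) \<longlongrightarrow> s *\<^sub>R U True s w) (at 0)"
    by (simp add: has_vector_derivative_at_iff_quotient)
  have "((\<lambda>h. (1 / h) *\<^sub>R (U False h f - f)) \<longlongrightarrow> v) (at 0)"
    using assms by (simp add: gen_iff_derivative has_vector_derivative_at_iff_quotient)
  then have 1: "((\<lambda>h. U True (exp h * s) ((1 / h) *\<^sub>R (U False h f - f))) \<longlongrightarrow> U True s v) (at 0)"
    by (intro tendsto_U) (auto intro!: tendsto_eq_intros)
  show ?thesis
    using tendsto_add[OF 1 2]
    by (simp add: gen_iff_derivative has_vector_derivative_at_iff_quotient U_False_True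
        U_scaleR U_diff_vec flip: scaleR_add_right)
qed

lemma gen_U_diff_norm:
  assumes "gen j f v"
  shows "norm (U j t f - f) \<le> \<bar>t\<bar> * norm v"
proof -
  have "norm (U j t f - U j 0 f) \<le> norm v * norm (t - 0)"
  proof (rule differentiable_bound[of "UNIV" _ "\<lambda>s h. h *\<^sub>R U j s v"])
    show "((\<lambda>a. U j a f) has_derivative (\<lambda>h. h *\<^sub>R U j x v)) (at x within UNIV)" for x
      using gen_derivative[OF assms] by (simp add: has_vector_derivative_def)
    show "onorm (\<lambda>h. h *\<^sub>R U j x v) \<le> norm v" for x
      by (rule onorm_le) (simp add: mult.commute[of "norm v"] mult_left_mono U_norm)
  qed auto
  then show ?thesis by (simp add: mult.commute)
qed

text \<open>First-order Taylor expansion of the orbit: U j e f - f equals e v up to e * (e |w|), and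
  its norm is at most 2 |f| by contractivity. Dividing by e gives the claim.\<close>

lemma gen_landau:
  assumes "gen j f v" "gen j v w" and e: "e > 0"
  shows "norm v \<le> 2 / e * norm f + e * norm w"
proof -
  have "norm (U j e f - U j 0 f - (e - 0) *\<^sub>R U j 0 v) \<le> norm (e - 0) * (e * norm w)"
  proof (rule vector_differentiable_bound_linearization[where S="{0..e}" and f'="\<lambda>t. U j t v"])
    show "((\<lambda>t. U j t f) has_vector_derivative U j t v) (at t within {0..e})" for t
      by (rule gen_derivative[OF assms(1)])
    show "norm (U j x v - U j 0 v) \<le> e * norm w" if "x \<in> {0..e}" for x
    proof -
      have "\<bar>x\<bar> * norm w \<le> e * norm w"
        using that by (intro mult_right_mono) auto
      then show ?thesis using gen_U_diff_norm[OF assms(2), of x] by simp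
    qed
  qed (use e in \<open>auto simp: closed_segment_eq_real_ivl\<close>)
  then have "norm (e *\<^sub>R v) \<le> e * (e * norm w) + norm (U j e f - f)"
    using e norm_triangle_ineq4[of "U j e f - f" "U j e f - f - e *\<^sub>R v"] by simp
  also have "norm (U j e f - f) \<le> 2 * norm f"
    using norm_triangle_ineq4[of "U j e f" f] U_norm[of j e f] by simp
  finally have "e * norm v \<le> e * (2 / e * norm f + e * norm w)"
    using e by (simp add: distrib_left mult.commute[of 2])
  then show ?thesis using e by simp
qed

text \<open>U j h only shifts the window of integration from [0, t] to [h, t + h], so the derivative
  consists of the two boundary terms. This is where averages gain a derivative.\<close>

lemma gen_integral_U: "gen j (integral {0..t} (\<lambda>s. U j s f)) (U j t f - f)" if t: "t \<ge> 0"
proof -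
  \<comment> \<open>The primitive starts at -1 and not at 0, so that it is differentiable from both
    sides at 0 and at t.\<close>
  define I where "I x = integral {-1..x} (\<lambda>s. U j s f)" for x
  have ci: "(\<lambda>s. U j s f) integrable_on {a..b}" for a b
    by (intro integrable_continuous_interval continuous_intros)
  have I: "(I has_vector_derivative U j x f) (at x)" if "x > -1" for x
  proof -
    have "((\<lambda>x. integral {-1..x} (\<lambda>s. U j s f)) has_vector_derivative U j x f) (at x within {-1..x+1})"
      by (rule integral_has_vector_derivative) (use that in \<open>auto intro!: continuous_intros\<close>)
    then show ?thesis unfolding I_def[abs_def]
      using at_within_interior[of x "{-1..x+1}"] that by simp
  qed
  have shift: "U j h (integral {0..t} (\<lambda>s. U j s f)) = I (t + h) - I h" if h: "h > -1" for h
  proof -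
    have "U j h (integral {0..t} (\<lambda>s. U j s f)) = integral {0..t} (\<lambda>s. U j (s + h) f)"
      using integral_linear[OF ci U_bounded_linear, of 0 t j h]
      by (simp add: o_def) (simp add: add.commute flip: U_add)
    also have "\<dots> = integral {h..t + h} (\<lambda>s. U j s f)"
      using integral_shift_real_ivl[of h h "t+h" "\<lambda>s. U j s f"] by (simp add: o_def)
    also have "\<dots> = I (t + h) - I h"
      using Henstock_Kurzweil_Integration.integral_combine[OF _ _ ci, of "-1" h "t+h"] h t
      by (simp add: I_def eq_diff_eq add.commute)
    finally show ?thesis .
  qed
  have 0: "((\<lambda>h. I (t + h)) has_vector_derivative U j t f) (at 0)"
    using I[of t] that by (simp add: has_vector_derivative_at_iff_quotient)
  have "((\<lambda>h. I (t + h) - I h) has_vector_derivative U j t f - f) (at 0)"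
    using has_vector_derivative_diff[OF 0 I[of 0]] by simp
  then show ?thesis
    unfolding gen_iff_derivative
    by (rule has_vector_derivative_transform_within_open[where S="{-1<..}"]) (auto simp: shift)
qed

lemma gen_integral:
  fixes a b :: real
  assumes u: "continuous_on {a..b} u" and v: "continuous_on {a..b} v"
    and g: "\<And>s. s \<in> {a..b} \<Longrightarrow> gen j (u s) (v s)"
  shows "gen j (integral {a..b} u) (integral {a..b} v)"
proof -
  have "((\<lambda>h. integral (cbox a b) (\<lambda>s. U j h (u s))) has_vector_derivative
      integral (cbox a b) (\<lambda>s. U j 0 (v s))) (at 0 within UNIV)"
  proof (rule leibniz_rule_vector_derivative)
    show "continuous_on (UNIV \<times> cbox a b) (\<lambda>(h, s). U j h (v s))"
      unfolding case_prod_beta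
      by (intro continuous_intros continuous_on_compose2[OF v]) auto
  qed (use u in \<open>auto intro!: gen_derivative g integrable_continuous_interval continuous_intros\<close>)
  moreover have "integral (cbox a b) (\<lambda>s. U j h (u s)) = U j h (integral {a..b} u)" for h
    using integral_linear[OF integrable_continuous_interval[OF u] U_bounded_linear, of j h]
    by (simp add: o_def)
  ultimately show ?thesis
    by (simp add: gen_iff_derivative)
qed

text \<open>Closedness of the generator, needed to differentiate infinite series. The Taylor
  remainder is bounded uniformly in n by the modulus of continuity of the orbit of
  \<open>v0\<close>.\<close>

lemma gen_closed:
  assumes f: "f \<longlonglongrightarrow> f0" and v: "v \<longlonglongrightarrow> v0" and g: "\<And>n. gen j (f n) (v n)"
  shows "gen j f0 v0"
proof -
  have bd: "norm (U j t f0 - f0 - t *\<^sub>R v0) \<le> \<bar>t\<bar> * e" 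
    if e: "\<And>s. \<bar>s\<bar> \<le> \<bar>t\<bar> \<Longrightarrow> norm (U j s v0 - v0) \<le> e" for t e
  proof (rule LIMSEQ_le)
    show "(\<lambda>n. norm (U j t (f n) - f n - t *\<^sub>R v n)) \<longlonglongrightarrow> norm (U j t f0 - f0 - t *\<^sub>R v0)"
      by (intro tendsto_intros tendsto_U f v)
    show "(\<lambda>n. \<bar>t\<bar> * (e + 2 * norm (v n - v0))) \<longlonglongrightarrow> \<bar>t\<bar> * e"
      using v by (auto intro!: tendsto_eq_intros LIM_zero)
    show "\<exists>N. \<forall>n\<ge>N. norm (U j t (f n) - f n - t *\<^sub>R v n) \<le> \<bar>t\<bar> * (e + 2 * norm (v n - v0))"
    proof (intro exI allI impI)
      fix n
      have "norm (U j t (f n) - U j 0 (f n) - (t - 0) *\<^sub>R U j 0 (v n)) \<le> norm (t - 0) * (e + 2 * norm (v n - v0))"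
      proof (rule vector_differentiable_bound_linearization[where S="closed_segment 0 t" and f'="\<lambda>t. U j t (v n)"])
        show "((\<lambda>t. U j t (f n)) has_vector_derivative U j t (v n)) (at t within closed_segment 0 t')" for t t'
          by (rule gen_derivative[OF g])
        show "norm (U j x (v n) - U j 0 (v n)) \<le> e + 2 * norm (v n - v0)" if "x \<in> closed_segment 0 t" for x
        proof -
          \<comment> \<open>The dependence on n is confined to two terms of size at most norm (v n -
            v0), so n can go to infinity for fixed t before t tends to 0.\<close>
          have "U j x (v n) - v n = U j x (v n - v0) + (U j x v0 - v0) - (v n - v0)"
            by (simp add: U_diff_vec)
          then have "norm (U j x (v n) - v n) \<le> norm (U j x (v n - v0)) + norm (U j x v0 - v0) + norm (v n - v0)"
            using norm_triangle_ineq4[of "U j x (v n - v0) + (U j x v0 - v0)" "v n - v0"]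
              norm_triangle_ineq[of "U j x (v n - v0)" "U j x v0 - v0"] by simp
          moreover have "norm (U j x v0 - v0) \<le> e"
            using that by (intro e) (auto simp: closed_segment_eq_real_ivl split: if_splits)
          ultimately show ?thesis using U_norm[of j x "v n - v0"] by simp
        qed
      qed auto
      then show "norm (U j t (f n) - f n - t *\<^sub>R v n) \<le> \<bar>t\<bar> * (e + 2 * norm (v n - v0))" by simp
    qed
  qed
  have c: "isCont (\<lambda>s. U j s v0) 0"
    using U_continuous continuous_on_eq_continuous_at by blast
  show ?thesis
    unfolding gen_iff_derivative has_vector_derivative_at_iff_quotient
  proof (rule LIM_I)
    fix r :: real assume "r > 0"
    then have "r / 2 > 0" by simp
    with c have "\<exists>d>0. \<forall>s. \<bar>s\<bar> < d \<longrightarrow> norm (U j s v0 - v0) < r / 2"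
      unfolding continuous_at_eps_delta by (auto simp: dist_norm simp del: half_gt_zero_iff less_divide_eq_numeral1)
    then obtain d where d: "d > 0" "\<And>s. \<bar>s\<bar> < d \<Longrightarrow> norm (U j s v0 - v0) < r / 2"
      by blast
    show "\<exists>s>0. \<forall>x. x \<noteq> 0 \<and> norm (x - 0) < s \<longrightarrow> norm ((1 / x) *\<^sub>R (U j (0 + x) f0 - U j 0 f0) - v0) < r"
    proof (intro exI[of _ d] conjI allI impI d)
      fix x :: real assume x: "x \<noteq> 0 \<and> norm (x - 0) < d"
      have "(1 / x) *\<^sub>R (U j x f0 - f0) - v0 = (1 / x) *\<^sub>R (U j x f0 - f0 - x *\<^sub>R v0)"
        using x by (simp add: scaleR_diff_right)
      also have "norm \<dots> \<le> (1 / \<bar>x\<bar>) * (\<bar>x\<bar> * (r / 2))"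
        unfolding norm_scaleR using x d(2)
        by (intro mult_mono bd) (auto intro: less_imp_le)
      also have "\<dots> < r" using x \<open>r > 0\<close> by simp
      finally show "norm ((1 / x) *\<^sub>R (U j (0 + x) f0 - U j 0 f0) - v0) < r" by simp
    qed
  qed
qed

section \<open>The spaces of differentiable vectors\<close>

text \<open>A total version of the generator; off the domain its value carries no information, and
  membership in \<open>E (Suc k)\<close> ensures that f is in the domain.\<close>

definition A where "A j f = the (generator T j f)"

abbreviation "E \<equiv> Ek T"
abbreviation "N \<equiv> Ek_norm T"

lemma generator_eq_Some_iff: "generator T j f = Some v \<longleftrightarrow> gen j f v"
proof
  assume "generator T j f = Some v"
  then have "\<exists>w. gen j f w" "v = (THE w. gen j f w)"
    by (auto simp: generator_def split: if_splits)
  then show "gen j f v" using gen_unique by (metis theI)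
next
  assume v: "gen j f v"
  then have "(THE w. gen j f w) = v" using gen_unique by blast
  then show "generator T j f = Some v" using v by (auto simp: generator_def)
qed

lemma A_eq: "gen j f v \<Longrightarrow> A j f = v"
  by (simp add: A_def generator_eq_Some_iff[symmetric])

text \<open>\<open>gen_word\<close> recurses on the outermost generator. Inductions on the order
  need the innermost one, the last letter, so that the hypothesis applies to A_j f.\<close>

lemma gen_word_snoc: "gen_word T (ws @ [j]) f = Option.bind (generator T j f) (gen_word T ws)"
  by (induction ws) (cases "generator T j f"; simp)+

lemma Ek_0 [simp]: "f \<in> E 0"
  by (simp add: Ek_def)

lemma Ek_Suc: "f \<in> E (Suc k) \<longleftrightarrow> (\<forall>j. gen j f (A j f) \<and> A j f \<in> E k)"
proof
  assume f: "f \<in> E (Suc k)"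
  have w: "gen_word T (ws @ [j]) f \<noteq> None" if "length ws \<le> k" for ws j
    using f that by (simp add: Ek_def)
  have g: "generator T j f = Some (A j f)" for j
    using w[of "[]" j] by (auto simp: A_def)
  then show "\<forall>j. gen j f (A j f) \<and> A j f \<in> E k"
    using w by (auto simp: Ek_def gen_word_snoc simp flip: generator_eq_Some_iff)
next
  assume f: "\<forall>j. gen j f (A j f) \<and> A j f \<in> E k"
  show "f \<in> E (Suc k)"
    unfolding Ek_def
  proof (intro CollectI allI impI)
    fix ws :: "bool list" assume "length ws \<le> Suc k"
    then show "gen_word T ws f \<noteq> None"
      using f by (cases ws rule: rev_cases)
        (auto simp: gen_word_snoc Ek_def simp flip: generator_eq_Some_iff)
  qed
qed

lemma finite_words: "finite {ws :: bool list. length ws \<le> k}"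
  using finite_lists_length_le[of "UNIV :: bool set" k] by simp

lemma N_0 [simp]: "N 0 f = norm f"
  by (simp add: Ek_norm_def)

text \<open>A word of length at most k + 1 is empty or ends in exactly one of the two letters, so
  the sum splits exactly. All later inductions use the norm through this recursion.\<close>

lemma N_Suc:
  assumes "f \<in> E (Suc k)"
  shows "N (Suc k) f = norm f + N k (A False f) + N k (A True f)"
proof -
  let ?W = "{ws :: bool list. length ws \<le> k}" and ?h = "\<lambda>ws. norm (the (gen_word T ws f))"
  have W: "{ws :: bool list. length ws \<le> Suc k} = insert [] ((\<lambda>ws. ws @ [False]) ` ?W \<union> (\<lambda>ws. ws @ [True]) ` ?W)"
    (is "?L = ?R")
  proof (intro subset_antisym subsetI)
    fix ws assume "ws \<in> ?L"
    then show "ws \<in> ?R" by (cases ws rule: rev_cases) (auto simp: image_iff)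
  qed auto
  have "N (Suc k) f = ?h [] + (sum ?h ((\<lambda>ws. ws @ [False]) ` ?W) + sum ?h ((\<lambda>ws. ws @ [True]) ` ?W))"
    unfolding Ek_norm_def W using finite_words[of k]
    by (subst sum.insert) (auto intro!: sum.union_disjoint)
  moreover have "sum ?h ((\<lambda>ws. ws @ [j]) ` ?W) = N k (A j f)" for j
    using assms by (subst sum.reindex)
      (auto simp: Ek_norm_def gen_word_snoc inj_on_def Ek_Suc simp flip: generator_eq_Some_iff)
  ultimately show ?thesis by simp
qed

lemma Ek_SucI:
  assumes "\<And>j. gen j f (v j)" "\<And>j. v j \<in> E k"
  shows "f \<in> E (Suc k)" "N (Suc k) f = norm f + N k (v False) + N k (v True)"
proof -
  have "A j f = v j" for j using assms A_eq by blast
  then show "f \<in> E (Suc k)" using assms by (simp add: Ek_Suc)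
  then show "N (Suc k) f = norm f + N k (v False) + N k (v True)"
    using \<open>\<And>j. A j f = v j\<close> by (simp add: N_Suc)
qed

lemma Ek_SucD: 
  assumes "f \<in> E (Suc k)" shows "gen j f (A j f)" "A j f \<in> E k"
  using assms by (auto simp: Ek_Suc)

lemma N_nonneg: "0 \<le> N k f"
  by (simp add: Ek_norm_def sum_nonneg)

lemma norm_le_N: "norm f \<le> N k f"
  using member_le_sum[of "[]" "{ws. length ws \<le> k}" "\<lambda>ws. norm (the (gen_word T ws f))"]
  by (simp add: Ek_norm_def finite_words)

lemma N_A_le: "f \<in> E (Suc k) \<Longrightarrow> N k (A j f) \<le> N (Suc k) f"
  using N_nonneg[of k "A False f"] N_nonneg[of k "A True f"] by (cases j) (auto simp: N_Suc)

lemma Ek_antimono: "k \<le> l \<Longrightarrow> f \<in> E l \<Longrightarrow> f \<in> E k"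
  by (auto simp: Ek_def)

lemma N_mono: "k \<le> l \<Longrightarrow> N k f \<le> N l f"
  unfolding Ek_norm_def by (rule sum_mono2) (auto simp: finite_words)

lemma Ek_add:
  assumes "f \<in> E k" "g \<in> E k"
  shows "f + g \<in> E k \<and> N k (f + g) \<le> N k f + N k g"
  using assms
proof (induction k arbitrary: f g)
  case 0
  then show ?case by (simp add: norm_triangle_ineq)
next
  case (Suc k)
  note f = Ek_SucD[OF Suc.prems(1)] and g = Ek_SucD[OF Suc.prems(2)]
  note s = Ek_SucI[of "f + g" "\<lambda>j. A j f + A j g" k, OF gen_add[OF f(1) g(1)]]
  have IH: "A j f + A j g \<in> E k" "N k (A j f + A j g) \<le> N k (A j f) + N k (A j g)" for j
    using Suc.IH[OF f(2) g(2)] by auto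
  show ?case
    using s[OF IH(1)] IH(2)[of False] IH(2)[of True] norm_triangle_ineq[of f g]
    by (simp add: N_Suc[OF Suc.prems(1)] N_Suc[OF Suc.prems(2)])
qed

lemma Ek_scaleR:
  assumes "f \<in> E k"
  shows "c *\<^sub>R f \<in> E k \<and> N k (c *\<^sub>R f) = \<bar>c\<bar> * N k f"
  using assms
proof (induction k arbitrary: f)
  case (Suc k)
  note f = Ek_SucD[OF Suc.prems]
  note s = Ek_SucI[of "c *\<^sub>R f" "\<lambda>j. c *\<^sub>R A j f" k, OF gen_scaleR[OF f(1)]]
  show ?case
    using s Suc.IH[OF f(2)] by (simp add: N_Suc[OF Suc.prems] distrib_left)
qed simp

lemma Ek_diff:
  assumes "f \<in> E k" "g \<in> E k"
  shows "f - g \<in> E k \<and> N k (f - g) \<le> N k f + N k g"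
  using Ek_add[OF assms(1), of "(-1) *\<^sub>R g"] Ek_scaleR[OF assms(2), of "-1"] by auto

lemma Ek_zero [simp]: "0 \<in> E k" "N k 0 = 0"
proof -
  have "0 \<in> E k \<and> N k 0 = 0"
  proof (induction k)
    case (Suc k)
    have "gen j 0 0" for j
      unfolding has_generator_value_def using U_scaleR[of j _ 0 0] by simp
    then show ?case using Ek_SucI[of 0 "\<lambda>_. 0" k] Suc by simp
  qed simp
  then show "0 \<in> E k" "N k 0 = 0" by auto
qed

text \<open>For T_2 the derivative A_1 yields the additional term s A_2, so A_2 f may be counted
  twice: a factor 2 per order when s \<le> 1. For T_1 only exp (-s) \<le> 1 appears, which uses s
  \<ge> 0.\<close>

lemma Ek_U:
  assumes "f \<in> E k" "0 \<le> s" "s \<le> 1"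
  shows "U j s f \<in> E k \<and> N k (U j s f) \<le> 2 ^ k * N k f"
  using assms(1)
proof (induction k arbitrary: f)
  case 0
  then show ?case by (simp add: U_norm)
next
  case (Suc k)
  note f = Ek_SucD[OF Suc.prems]
  have IH: "U j s (A i f) \<in> E k" "N k (U j s (A i f)) \<le> 2 ^ k * N k (A i f)" for i
    using Suc.IH[OF f(2)] by auto
  note n = N_nonneg[of k "A False f"] N_nonneg[of k "A True f"]
  have p: "norm (U j s f) \<le> 2 ^ Suc k * norm f"
    using U_norm[of j s f] mult_right_mono[OF one_le_power[of 2 "Suc k"], of "norm f"] by simp
  show ?case
  proof (cases j)
    case True
    let ?v = "\<lambda>i. if i then U True s (A True f) else U True s (A False f) + s *\<^sub>R U True s (A True f)"
    note sc = Ek_scaleR[OF IH(1)[of True], of s]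
    note ad = Ek_add[OF IH(1)[of False] conjunct1[OF sc]]
    have s: "U True s f \<in> E (Suc k)" "N (Suc k) (U True s f) = norm (U True s f) + N k (?v False) + N k (?v True)"
      using Ek_SucI[of "U True s f" ?v k] ad IH(1) f(1) True by (auto simp: gen_U gen_False_U_True)
    have "s * N k (U True s (A True f)) \<le> 1 * (2 ^ k * N k (A True f))"
      using assms IH(2)[of True] True N_nonneg by (intro mult_mono) auto
    then have "N k (?v False) + N k (?v True) \<le> 2 ^ k * N k (A False f) + 2 * (2 ^ k * N k (A True f))"
      using IH(2)[of False] IH(2)[of True] ad sc True assms by simp
    also have "\<dots> \<le> 2 ^ Suc k * (N k (A False f) + N k (A True f))"
      using n by (simp add: algebra_simps)
    finally show ?thesis
      using s p True by (simp add: N_Suc[OF Suc.prems] algebra_simps)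
  next
    case False
    let ?v = "\<lambda>i. if i then exp (- s) *\<^sub>R U False s (A True f) else U False s (A False f)"
    note sc = Ek_scaleR[OF IH(1)[of True], of "exp (- s)"]
    have s: "U False s f \<in> E (Suc k)" "N (Suc k) (U False s f) = norm (U False s f) + N k (?v False) + N k (?v True)"
      using Ek_SucI[of "U False s f" ?v k] sc IH(1) f(1) False by (auto simp: gen_U gen_True_U_False)
    have "exp (- s) * N k (U False s (A True f)) \<le> 1 * (2 ^ k * N k (A True f))"
      using assms IH(2)[of True] False N_nonneg by (intro mult_mono) auto
    then have "N k (?v False) + N k (?v True) \<le> 2 ^ k * (N k (A False f) + N k (A True f))"
      using IH(2)[of False] sc False by (simp add: algebra_simps)
    also have "\<dots> \<le> 2 ^ Suc k * (N k (A False f) + N k (A True f))"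
      using n by (intro mult_right_mono) auto
    finally show ?thesis
      using s p False by (simp add: N_Suc[OF Suc.prems] algebra_simps)
  qed
qed

text \<open>One derivative is traded for a factor s. The commutation errors s A_2 and (exp (-s) - 1)
  A_2 are themselves of order s, hence harmless. The base 3 adds one unit for the norm and two for
  the generator parts.\<close>

lemma N_U_diff:
  assumes "f \<in> E (Suc k)" "0 \<le> s" "s \<le> 1"
  shows "N k (U j s f - f) \<le> 3 ^ k * s * N (Suc k) f"
  using assms(1)
proof (induction k arbitrary: f)
  case 0
  note f = Ek_SucD[OF 0]
  have "norm (U j s f - f) \<le> s * norm (A j f)"
    using gen_U_diff_norm[OF f(1), of j s] assms by simp
  also have "\<dots> \<le> s * N 1 f"
    using N_A_le[OF 0, of j] assms by (intro mult_left_mono) auto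
  finally show ?case by simp
next
  case (Suc k)
  note f = Ek_SucD[OF Suc.prems]
  have fk: "f \<in> E (Suc k)" using Suc.prems by (rule Ek_antimono[rotated]) simp
  have Af: "A i f \<in> E k" for i using f(2) by (rule Ek_antimono[rotated]) simp
  have IH: "N k (U j s (A i f) - A i f) \<le> 3 ^ k * s * N (Suc k) (A i f)" for i
    by (rule Suc.IH[OF f(2)])
  have UA: "U j s (A i f) \<in> E k" "N k (U j s (A i f)) \<le> 2 ^ k * N k (A i f)" for i
    using Ek_U[OF Af] assms by auto
  have D: "U j s (A i f) - A i f \<in> E k" for i
    using Ek_diff[OF UA(1) Af] by blast
  let ?a = "N (Suc k) (A False f)" and ?b = "N (Suc k) (A True f)"
  have n: "N k (A True f) \<le> ?b" by (simp add: N_mono)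
  have n0: "0 \<le> ?a" "0 \<le> ?b" "0 \<le> N (Suc (Suc k)) f" by (simp_all add: N_nonneg)
  have 23: "(2::real) ^ k \<le> 3 ^ k" by (simp add: power_mono)
  have b: "s * N k (A True f) \<le> s * ?b" using n assms by (intro mult_left_mono)
  have b2: "s * N k (U j s (A True f)) \<le> 3 ^ k * s * ?b"
  proof -
    have "N k (U j s (A True f)) \<le> 3 ^ k * ?b"
      using UA(2)[of True] mult_mono[OF 23 n] N_nonneg by (smt (verit) zero_le_power)
    then have "s * N k (U j s (A True f)) \<le> s * (3 ^ k * ?b)"
      using assms by (intro mult_left_mono)
    then show ?thesis by (simp add: ac_simps)
  qed
  have "norm (U j s f - f) \<le> s * norm (A j f)"
    using gen_U_diff_norm[OF f(1), of j s] assms by simp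
  also have "\<dots> \<le> s * (?a + ?b)"
    using norm_le_N[of "A j f" "Suc k"] n0 assms by (intro mult_left_mono) (cases j; simp)+
  finally have nm: "norm (U j s f - f) \<le> 3 ^ k * s * (?a + ?b)"
    using mult_right_mono[of 1 "3 ^ k" "s * (?a + ?b)"] n0 assms by (simp add: ac_simps)
  have tot: "?a + ?b \<le> N (Suc (Suc k)) f" by (simp add: N_Suc[OF Suc.prems])
  obtain v where v: "\<And>i. gen i (U j s f) (v i)" "\<And>i. v i - A i f \<in> E k"
    and le: "N k (v False - A False f) + N k (v True - A True f) \<le> 2 * (3 ^ k * s * (?a + ?b))"
  proof (cases j)
    case True
    let ?v = "\<lambda>i. if i then U True s (A True f) else U True s (A False f) + s *\<^sub>R U True s (A True f)"
    note sc = Ek_scaleR[OF UA(1)[of True], of s]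
    note ad = Ek_add[OF D[of False] conjunct1[OF sc]]
    have eq: "?v False - A False f = U j s (A False f) - A False f + s *\<^sub>R U j s (A True f)"
      using True by simp
    show ?thesis
    proof (rule that[of ?v])
      show "gen i (U j s f) (?v i)" for i using True f(1) by (auto simp: gen_U gen_False_U_True)
      show "?v i - A i f \<in> E k" for i using ad D[of True] True unfolding eq[symmetric] by (cases i) auto
      have "N k (?v False - A False f) \<le> 3 ^ k * s * ?a + 3 ^ k * s * ?b"
        unfolding eq using ad sc IH[of False] b2 assms by auto
      moreover have "N k (?v True - A True f) \<le> 3 ^ k * s * ?b"
        using IH[of True] True by simp
      moreover have "0 \<le> 3 ^ k * s * ?a" using assms n0 by simp
      ultimately show "N k (?v False - A False f) + N k (?v True - A True f) \<le> 2 * (3 ^ k * s * (?a + ?b))"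
        by (simp add: algebra_simps)
    qed
  next
    case False
    let ?v = "\<lambda>i. if i then exp (- s) *\<^sub>R U False s (A True f) else U False s (A False f)"
    note sc = Ek_scaleR[OF D[of True], of "exp (- s)"]
    note sc' = Ek_scaleR[OF Af[of True], of "exp (- s) - 1"]
    note ad = Ek_add[OF conjunct1[OF sc] conjunct1[OF sc']]
    \<comment> \<open>The first part is covered by the induction hypothesis, the second by |exp (-s)
      - 1| \<le> s.\<close>
    have eq: "?v True - A True f = exp (- s) *\<^sub>R (U j s (A True f) - A True f) + (exp (- s) - 1) *\<^sub>R A True f"
      using False by (simp add: scaleR_diff_right scaleR_diff_left)
    show ?thesis
    proof (rule that[of ?v])
      show "gen i (U j s f) (?v i)" for i using False f(1) by (auto simp: gen_U gen_True_U_False)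
      show "?v i - A i f \<in> E k" for i using ad D[of False] False unfolding eq[symmetric] by (cases i) auto
      have e: "\<bar>exp (- s) - 1\<bar> \<le> s"
        using exp_ge_add_one_self[of "- s"] assms by simp
      have "N k (?v True - A True f) \<le> exp (- s) * N k (U j s (A True f) - A True f) + \<bar>exp (- s) - 1\<bar> * N k (A True f)"
        unfolding eq using ad sc sc' by simp
      also have "\<dots> \<le> 1 * (3 ^ k * s * ?b) + s * ?b"
        using e assms IH[of True] n by (intro add_mono mult_mono) (auto simp: N_nonneg)
      also have "s * ?b \<le> 3 ^ k * s * ?b"
        using mult_right_mono[of 1 "3 ^ k" "s * ?b"] n0 assms by (simp add: ac_simps)
      finally have "N k (?v True - A True f) \<le> 1 * (3 ^ k * s * ?b) + 3 ^ k * s * ?b" by simp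
      moreover have "N k (?v False - A False f) \<le> 3 ^ k * s * ?a"
        using IH[of False] False by simp
      moreover have "0 \<le> 3 ^ k * s * ?a" using assms n0 by simp
      ultimately show "N k (?v False - A False f) + N k (?v True - A True f) \<le> 2 * (3 ^ k * s * (?a + ?b))"
        by (simp add: algebra_simps)
    qed
  qed
  have "gen i (U j s f - f) (v i - A i f)" for i
    using gen_add[OF v(1)[of i] gen_scaleR[OF f(1)[of i], where c="-1"]] by simp
  from Ek_SucI(2)[OF this v(2)]
  have "N (Suc k) (U j s f - f) \<le> 3 * (3 ^ k * s * (?a + ?b))"
    using nm le by simp
  also have "\<dots> \<le> 3 * (3 ^ k * s * N (Suc (Suc k)) f)"
    using tot assms by (intro mult_left_mono) auto
  finally show ?case by simp
qed

section \<open>Interpolation inequalities\<close>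

text \<open>At the bottom the Landau inequality bounds A_j f through f and A_j A_j f, a repeated
  letter. In the constant, 5 = 1 + 2 + 2 counts |f| \<le> |f| / e and both letters; every further
  order adds 1, for the norm of f itself.\<close>

lemma N_landau:
  assumes "f \<in> E (Suc (Suc k))" "0 < e" "e \<le> 1"
  shows "N (Suc k) f \<le> (5 + real k) * (e * N (Suc (Suc k)) f + N k f / e)"
  using assms(1)
proof (induction k arbitrary: f)
  case 0
  note f = Ek_SucD[OF 0] and f' = Ek_SucD[OF Ek_SucD(2)[OF 0]]
  have f1: "f \<in> E (Suc 0)" using 0 by (rule Ek_antimono[rotated]) simp
  have AA: "norm (A j (A j f)) \<le> N (Suc 0) (A j f)" for j
    using N_A_le[OF f(2), of j] by simp
  have A: "norm (A j f) \<le> 2 / e * norm f + e * N (Suc 0) (A j f)" for j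
    using gen_landau[OF f(1) f'(1) assms(2), of j] mult_left_mono[OF AA[of j] less_imp_le[OF assms(2)]]
    by linarith
  have "norm f \<le> norm f / e"
    using assms by (simp add: pos_le_divide_eq mult_left_le)
  then have "N (Suc 0) f \<le> norm f / e + (2 / e * norm f + e * N (Suc 0) (A False f)) + (2 / e * norm f + e * N (Suc 0) (A True f))"
    using A[of False] A[of True] by (simp add: N_Suc[OF f1])
  also have "\<dots> = 5 * (norm f / e) + e * (N (Suc 0) (A False f) + N (Suc 0) (A True f))"
    by (simp add: algebra_simps)
  also have "\<dots> \<le> 5 * (norm f / e) + 5 * (e * N (Suc (Suc 0)) f)"
    using assms N_nonneg[of "Suc 0" "A False f"] N_nonneg[of "Suc 0" "A True f"]
    by (simp add: N_Suc[OF 0])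
  finally show ?case by (simp add: algebra_simps)
next
  case (Suc k)
  note f = Ek_SucD[OF Suc.prems]
  have f2: "f \<in> E (Suc (Suc k))" and f1: "f \<in> E (Suc k)"
    using Suc.prems by (rule Ek_antimono[rotated]; simp)+
  have "norm f \<le> norm f / e"
    using assms by (simp add: pos_le_divide_eq mult_left_le)
  moreover have "norm f / e \<le> N (Suc k) f / e" using assms norm_le_N by (simp add: divide_right_mono)
  moreover have "0 \<le> e * N (Suc (Suc (Suc k))) f" using assms N_nonneg by simp
  ultimately have "norm f \<le> e * N (Suc (Suc (Suc k))) f + N (Suc k) f / e" by linarith
  then have "N (Suc (Suc k)) f \<le> (e * N (Suc (Suc (Suc k))) f + N (Suc k) f / e) +
      (5 + real k) * (e * N (Suc (Suc k)) (A False f) + N k (A False f) / e) +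
      (5 + real k) * (e * N (Suc (Suc k)) (A True f) + N k (A True f) / e)"
    unfolding N_Suc[OF f2] by (intro add_mono Suc.IH f(2))
  also have "\<dots> = (e * N (Suc (Suc (Suc k))) f + N (Suc k) f / e) +
      (5 + real k) * (e * (N (Suc (Suc k)) (A False f) + N (Suc (Suc k)) (A True f)) + (N k (A False f) + N k (A True f)) / e)"
    by (simp add: algebra_simps add_divide_distrib)
  also have "\<dots> \<le> (e * N (Suc (Suc (Suc k))) f + N (Suc k) f / e) +
      (5 + real k) * (e * N (Suc (Suc (Suc k))) f + N (Suc k) f / e)"
    using assms by (intro add_left_mono mult_left_mono add_mono divide_right_mono)
      (auto simp: N_Suc[OF Suc.prems] N_Suc[OF f1])
  finally show ?case by (simp add: algebra_simps add_divide_distrib)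
qed

text \<open>Induction on r. The hypothesis reduces every k \<le> r to the order r, where
  \<open>N_landau\<close> brings in N_(r-1); the hypothesis at a smaller scale bounds that by the
  norm and a small multiple of N_r, which is absorbed.\<close>

lemma N_interpolation_aux:
  "\<exists>C>0. \<forall>\<tau>. 0 < \<tau> \<longrightarrow> \<tau> \<le> 1 \<longrightarrow> (\<forall>k\<le>r. \<forall>f\<in>E r. \<tau> ^ k * N k f \<le> C * (norm f + \<tau> ^ r * N r f))"
proof (induction r)
  case 0
  show ?case by (rule exI[of _ 1]) auto
next
  case (Suc r)
  then obtain C where C: "C > 0"
    and le: "\<And>\<tau> k f. 0 < \<tau> \<Longrightarrow> \<tau> \<le> 1 \<Longrightarrow> k \<le> r \<Longrightarrow> f \<in> E r \<Longrightarrow> \<tau> ^ k * N k f \<le> C * (norm f + \<tau> ^ r * N r f)"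
    by blast
  obtain D where D: "D > 0"
    and Dle: "\<And>\<tau> f. 0 < \<tau> \<Longrightarrow> \<tau> \<le> 1 \<Longrightarrow> f \<in> E (Suc r) \<Longrightarrow> \<tau> ^ r * N r f \<le> D * (norm f + \<tau> ^ Suc r * N (Suc r) f)"
  proof (cases r)
    case 0
    show ?thesis by (rule that[of 1]) (auto simp: 0 N_nonneg)
  next
    case r: (Suc m)
    define L where "L = 5 + real m"
    \<comment> \<open>The scale is shrunk to c \<tau>, so that N_r returns with the factor L C c
      \<le> 1/2 and moves to the left side.\<close>
    define c where "c = 1 / (2 * L * C + 1)"
    have L: "L > 0" by (simp add: L_def)
    have c: "0 < c" "c \<le> 1" "L * C * c \<le> 1 / 2"
      using mult_pos_pos[OF L C] by (auto simp: c_def field_simps add_pos_pos)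
    have cm: "0 < c ^ m" using c by simp
    show ?thesis
    proof (rule that[of "2 * L + 2 * L * C / c ^ m"])
      show "0 < 2 * L + 2 * L * C / c ^ m" using L C cm by (simp add: add_pos_pos)
      fix \<tau> :: real and f assume t: "0 < \<tau>" "\<tau> \<le> 1" and f: "f \<in> E (Suc r)"
      from f have fr: "f \<in> E r" by (rule Ek_antimono[rotated]) simp
      define X where "X = \<tau> ^ r * N r f"
      define Y where "Y = \<tau> ^ Suc r * N (Suc r) f"
      have Y: "Y \<ge> 0" using t N_nonneg by (simp add: Y_def)
      have "(c * \<tau>) ^ m * N m f \<le> C * (norm f + (c * \<tau>) ^ r * N r f)"
        using t c by (intro le fr) (auto simp: r mult_le_one)
      also have "\<dots> = C * (norm f + c ^ m * (c * X))"
        by (simp add: X_def r power_mult_distrib)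
      finally have "\<tau> ^ m * N m f \<le> C * (norm f + c ^ m * (c * X)) / c ^ m"
        using cm by (simp add: pos_le_divide_eq power_mult_distrib ac_simps)
      also have "\<dots> = C / c ^ m * norm f + C * c * X"
        using cm by (simp add: distrib_left add_divide_distrib)
      finally have 1: "\<tau> ^ m * N m f \<le> C / c ^ m * norm f + C * c * X" .
      have "X \<le> \<tau> ^ r * (L * (\<tau> * N (Suc r) f + N m f / \<tau>))"
        unfolding X_def using N_landau[of f m \<tau>] f t by (intro mult_left_mono) (auto simp: r L_def)
      also have "\<dots> = L * (Y + \<tau> ^ m * N m f)"
        using t by (simp add: r Y_def distrib_left power_commutes)
      also have "\<dots> \<le> L * (Y + (C / c ^ m * norm f + C * c * X))"
        using 1 L by (intro mult_left_mono add_left_mono) auto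
      also have "\<dots> = L * Y + L * C / c ^ m * norm f + (L * C * c) * X"
        by (simp add: algebra_simps)
      also have "\<dots> \<le> L * Y + L * C / c ^ m * norm f + (1 / 2) * X"
        using c t N_nonneg by (intro add_left_mono mult_right_mono) (auto simp: X_def)
      finally have "X \<le> 2 * L * Y + 2 * L * C / c ^ m * norm f"
        by simp
      also have "\<dots> \<le> (2 * L + 2 * L * C / c ^ m) * (norm f + Y)"
        using L C cm Y by (simp add: distrib_left distrib_right)
      finally show "\<tau> ^ r * N r f \<le> (2 * L + 2 * L * C / c ^ m) * (norm f + \<tau> ^ Suc r * N (Suc r) f)"
        by (simp add: X_def Y_def)
    qed
  qed
  show ?case
  proof (intro exI[of _ "1 + C + C * D"] conjI allI impI ballI)
    show "0 < 1 + C + C * D" using C D by (simp add: add_pos_pos)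
    fix \<tau> :: real and k f assume t: "0 < \<tau>" "\<tau> \<le> 1" and k: "k \<le> Suc r" and f: "f \<in> E (Suc r)"
    define Y where "Y = \<tau> ^ Suc r * N (Suc r) f"
    have Y: "Y \<ge> 0" using t N_nonneg by (simp add: Y_def)
    have "\<tau> ^ k * N k f \<le> (1 + C + C * D) * (norm f + Y)"
    proof (cases "k = Suc r")
      case True
      have "Y \<le> 1 * (norm f + Y)" by simp
      also have "\<dots> \<le> (1 + C + C * D) * (norm f + Y)"
        using C D Y by (intro mult_right_mono) auto
      finally show ?thesis using True by (simp add: Y_def)
    next
      case False
      have "f \<in> E r" using f by (rule Ek_antimono[rotated]) simp
      then have "\<tau> ^ k * N k f \<le> C * (norm f + \<tau> ^ r * N r f)"
        using le t k False by simp
      also have "\<dots> \<le> C * ((norm f + Y) + D * (norm f + Y))"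
        using Dle[OF t f] C Y by (intro mult_left_mono add_mono) (auto simp: Y_def)
      also have "\<dots> = (C + C * D) * (norm f + Y)" by (simp add: algebra_simps)
      also have "\<dots> \<le> (1 + C + C * D) * (norm f + Y)"
        using Y by (intro mult_right_mono) auto
      finally show ?thesis .
    qed
    then show "\<tau> ^ k * N k f \<le> (1 + C + C * D) * (norm f + \<tau> ^ Suc r * N (Suc r) f)"
      by (simp add: Y_def)
  qed
qed

lemma N_interpolation:
  obtains C where "C > 0" 
    "\<And>\<tau> k f. 0 < \<tau> \<Longrightarrow> k \<le> r \<Longrightarrow> f \<in> E r \<Longrightarrow> \<tau> ^ k * N k f \<le> C * (norm f + \<tau> ^ r * N r f)"
proof -
  obtain C where C: "C > 0"
    and le: "\<And>\<tau> k f. 0 < \<tau> \<Longrightarrow> \<tau> \<le> 1 \<Longrightarrow> k \<le> r \<Longrightarrow> f \<in> E r \<Longrightarrow> \<tau> ^ k * N k f \<le> C * (norm f + \<tau> ^ r * N r f)"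
    using N_interpolation_aux[of r] by blast
  show ?thesis
  proof (rule that[of "C + 1"])
    fix \<tau> :: real and k f assume t: "0 < \<tau>" and k: "k \<le> r" and f: "f \<in> E r"
    let ?Z = "norm f + \<tau> ^ r * N r f"
    have Z: "?Z \<ge> 0" using t N_nonneg by simp
    show "\<tau> ^ k * N k f \<le> (C + 1) * ?Z"
    proof (cases "\<tau> \<le> 1")
      case True
      then show ?thesis using le[OF t True k f] Z by (simp add: distrib_right)
    next
      case False
      \<comment> \<open>Large scales are trivial: the norms are inhomogeneous, so both factors
        increase with the order.\<close>
      then have "\<tau> ^ k * N k f \<le> \<tau> ^ r * N r f"
        using k by (intro mult_mono power_increasing N_mono) (auto simp: N_nonneg)
      also have "\<dots> \<le> 1 * ?Z" by simp
      also have "\<dots> \<le> (C + 1) * ?Z" using C Z by (intro mult_right_mono) auto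
      finally show ?thesis .
    qed
  qed (use C in simp)
qed

section \<open>Smoothing by averages\<close>

text \<open>Continuity of a curve as a map into \<open>E k\<close>.\<close>

fun curve ::"nat \<Rightarrow> real \<Rightarrow> (real \<Rightarrow> 'a) \<Rightarrow> bool" where
  "curve 0 b u \<longleftrightarrow> continuous_on {0..b} u"
| "curve (Suc k) b u \<longleftrightarrow> continuous_on {0..b} u \<and>
     (\<exists>v. \<forall>j. (\<forall>s\<in>{0..b}. gen j (u s) (v j s)) \<and> curve k b (v j))"

lemma curve_SucI:
  assumes "continuous_on {0..b} u" "\<And>j s. s \<in> {0..b} \<Longrightarrow> gen j (u s) (v j s)" "\<And>j. curve k b (v j)"
  shows "curve (Suc k) b u"
  unfolding curve.simps using assms by blast

lemma curve_SucE:
  assumes "curve (Suc k) b u"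
  obtains v where "\<And>j s. s \<in> {0..b} \<Longrightarrow> gen j (u s) (v j s)" "\<And>j. curve k b (v j)"
  using assms unfolding curve.simps by blast

lemma curve_continuous: "curve k b u \<Longrightarrow> continuous_on {0..b} u"
  by (cases k) auto

lemma curve_Ek: "curve k b u \<Longrightarrow> s \<in> {0..b} \<Longrightarrow> u s \<in> E k"
proof (induction k arbitrary: u)
  case (Suc k)
  obtain v where "\<And>j s. s \<in> {0..b} \<Longrightarrow> gen j (u s) (v j s)" "\<And>j. curve k b (v j)"
    using curve_SucE[OF Suc.prems(1)] by blast
  then show ?case using Suc by (intro Ek_SucI(1)[of _ "\<lambda>j. v j s"]) auto
qed simp

lemma curve_add: "curve k b u \<Longrightarrow> curve k b w \<Longrightarrow> curve k b (\<lambda>s. u s + w s)"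
proof (induction k arbitrary: u w)
  case 0 then show ?case by (simp add: continuous_on_add)
next
  case (Suc k)
  obtain v where v: "\<And>j s. s \<in> {0..b} \<Longrightarrow> gen j (u s) (v j s)" "\<And>j. curve k b (v j)"
    using curve_SucE[OF Suc.prems(1)] by blast
  obtain v' where v': "\<And>j s. s \<in> {0..b} \<Longrightarrow> gen j (w s) (v' j s)" "\<And>j. curve k b (v' j)"
    using curve_SucE[OF Suc.prems(2)] by blast
  show ?case
    by (rule curve_SucI[where v="\<lambda>j s. v j s + v' j s"])
      (use Suc.prems in \<open>auto intro!: continuous_on_add gen_add v v' Suc.IH\<close>)
qed

lemma curve_scaleR: "curve k b u \<Longrightarrow> continuous_on {0..b} c \<Longrightarrow> curve k b (\<lambda>s. c s *\<^sub>R u s)"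
proof (induction k arbitrary: u)
  case 0 then show ?case by (simp add: continuous_on_scaleR)
next
  case (Suc k)
  obtain v where v: "\<And>j s. s \<in> {0..b} \<Longrightarrow> gen j (u s) (v j s)" "\<And>j. curve k b (v j)"
    using curve_SucE[OF Suc.prems(1)] by blast
  show ?case
    by (rule curve_SucI[where v="\<lambda>j s. c s *\<^sub>R v j s"])
      (use Suc.prems in \<open>auto intro!: continuous_on_scaleR gen_scaleR v Suc.IH\<close>)
qed

lemma curve_const: "f \<in> E k \<Longrightarrow> curve k b (\<lambda>_. f)"
proof (induction k arbitrary: f)
  case (Suc k)
  show ?case
    by (rule curve_SucI[where v="\<lambda>j s. A j f"])
      (use Suc.prems in \<open>auto intro!: Suc.IH simp: Ek_Suc\<close>)
qed simp

lemma curve_U: "f \<in> E k \<Longrightarrow> curve k b (\<lambda>s. U j s f)"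
proof (induction k arbitrary: f)
  case 0 then show ?case by (auto intro!: continuous_intros)
next
  case (Suc k)
  note f = Ek_SucD[OF Suc.prems]
  have c: "continuous_on {0..b} (\<lambda>s. U j s f)" by (intro continuous_intros)
  note intros = curve_add curve_scaleR continuous_intros
  show ?case
  proof (cases j)
    case True
    have IH: "curve k b (\<lambda>s. U True s (A i f))" for i using Suc.IH[OF f(2)[of i]] True by simp
    let ?v = "\<lambda>i s. if i then U True s (A True f) else U True s (A False f) + s *\<^sub>R U True s (A True f)"
    have "curve k b (?v i)" for i
      using IH by (cases i) (auto intro!: intros)
    then show ?thesis
      by (intro curve_SucI[OF c, where v="?v"]) (use True f(1) in \<open>auto simp: gen_U gen_False_U_True\<close>)
  next
    case False
    have IH: "curve k b (\<lambda>s. U False s (A i f))" for i using Suc.IH[OF f(2)[of i]] False by simp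
    let ?v = "\<lambda>i s. if i then exp (- s) *\<^sub>R U False s (A True f) else U False s (A False f)"
    have "curve k b (?v i)" for i
      using IH by (cases i) (auto intro!: intros)
    then show ?thesis
      by (intro curve_SucI[OF c, where v="?v"]) (use False f(1) in \<open>auto simp: gen_U gen_True_U_False\<close>)
  qed
qed

text \<open>Each of the three summands of N_(k+1) is bounded by the full \<open>M\<close>, a factor
  3 per order. A uniform bound suffices, so the function s \<mapsto> N k (u s) never has to be
  integrated.\<close>

lemma integral_Ek:
  assumes "curve k b u" "0 \<le> b" "\<And>s. s \<in> {0..b} \<Longrightarrow> N k (u s) \<le> M"
  shows "integral {0..b} u \<in> E k \<and> N k (integral {0..b} u) \<le> 3 ^ k * (b * M)"
  using assms(1,3)
proof (induction k arbitrary: u)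
  case 0
  then show ?case
    using integral_bound[of 0 b u M] assms(2) by (simp add: mult.commute)
next
  case (Suc k)
  obtain v where v: "\<And>j s. s \<in> {0..b} \<Longrightarrow> gen j (u s) (v j s)" "\<And>j. curve k b (v j)"
    using curve_SucE[OF Suc.prems(1)] by blast
  have c: "continuous_on {0..b} u" using Suc.prems(1) by (rule curve_continuous)
  have uE: "u s \<in> E (Suc k)" if "s \<in> {0..b}" for s using curve_Ek Suc.prems that by blast
  have "N k (v j s) \<le> M" if "s \<in> {0..b}" for j s
    using N_A_le[OF uE[OF that], of j] A_eq[OF v(1)[OF that], of j] Suc.prems(2)[OF that] by simp
  from Suc.IH[OF v(2) this]
  have IH: "integral {0..b} (v j) \<in> E k" "N k (integral {0..b} (v j)) \<le> 3 ^ k * (b * M)" for j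
    by auto
  have M: "M \<ge> 0" using Suc.prems(2)[of 0] assms(2) N_nonneg[of "Suc k" "u 0"] by auto
  have "norm (u s) \<le> M" if "s \<in> {0..b}" for s
    using norm_le_N[of "u s"] Suc.prems(2)[OF that] by (rule order_trans)
  then have nm: "norm (integral {0..b} u) \<le> b * M"
    using integral_bound[of 0 b u M] assms(2) c by (simp add: mult.commute)
  have "b * M \<le> 3 ^ k * (b * M)"
    using mult_right_mono[OF one_le_power[of 3 k], of "b * M"] M assms(2) by simp
  moreover note Ek_SucI[of "integral {0..b} u" "\<lambda>j. integral {0..b} (v j)" k, OF gen_integral IH(1)]
  ultimately show ?case
    using v c IH(2)[of False] IH(2)[of True] nm curve_continuous[OF v(2)] by simp
qed

text \<open>T_1 is the outer factor: A_2 passes it with only the scalar exp (-t) and then meets the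
  T_2-integral, of which it is the exact derivative. So both generators of the double integral give
  increments of vectors in E^(k+1). In \<open>B\<close>, 6 = 3 * 2 combines
  \<open>integral_Ek\<close> with \<open>Ek_U\<close>, and 2^(k+1) + 1 bounds an increment U x -
  x.\<close>

lemma averaging:
  assumes f: "f \<in> E (Suc k)" and \<tau>: "0 < \<tau>" "\<tau> \<le> 1"
  defines "B \<equiv> (2 ^ Suc k + 1) * 6 ^ Suc k"
  shows "\<exists>g\<in>E (Suc (Suc k)). N (Suc (Suc k)) g \<le> (1 + 2 * B) / \<tau> * N (Suc k) f \<and>
           N k (f - g) \<le> 9 ^ k * (1 + 6 ^ Suc k) * \<tau> * N (Suc k) f"
proof -
  define h where "h = integral {0..\<tau>} (\<lambda>s. U True s f)"
  define w where "w = integral {0..\<tau>} (\<lambda>t. U False t h)"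
  define d where "d = U True \<tau> f - f"
  define g where "g = (1 / \<tau>\<^sup>2) *\<^sub>R w"
  let ?m = "Suc k" and ?n = "N (Suc k) f"
  have n0: "0 \<le> ?n" by (rule N_nonneg)
  have int: "(\<lambda>s. U j s x) integrable_on {0..\<tau>}" for j x
    by (intro integrable_continuous_interval continuous_intros)
  have "N ?m (U True s f) \<le> 2 ^ ?m * ?n" if "s \<in> {0..\<tau>}" for s
    using Ek_U[OF f, of s True] that \<tau> by auto
  from integral_Ek[OF curve_U[OF f] _ this]
  have h: "h \<in> E ?m" "N ?m h \<le> 6 ^ ?m * (\<tau> * ?n)"
    using \<tau> by (auto simp: h_def ac_simps simp flip: power_mult_distrib)
  have d: "d \<in> E ?m" "N ?m d \<le> (2 ^ ?m + 1) * ?n"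
    using Ek_U[OF f, of \<tau> True] Ek_diff[of "U True \<tau> f" ?m f] f \<tau> by (auto simp: d_def distrib_right)
  have gh: "gen True h d"
    using gen_integral_U \<tau> by (simp add: h_def d_def)
  \<comment> \<open>A_1 gives the boundary terms of the outer integral; A_2 goes inside and gives
    \<open>d\<close>, the boundary terms of the inner one.\<close>
  define v where "v j = (if j then integral {0..\<tau>} (\<lambda>t. exp (- t) *\<^sub>R U False t d) else U False \<tau> h - h)" for j
  have c: "curve ?m \<tau> (\<lambda>t. exp (- t) *\<^sub>R U False t d)"
    by (intro curve_scaleR curve_U d continuous_intros)
  have gw: "gen j w (v j)" for j
  proof (cases j)
    case True
    have "gen True (U False t h) (exp (- t) *\<^sub>R U False t d)" for t
      by (rule gen_True_U_False[OF gh])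
    then show ?thesis
      using True by (auto simp: w_def v_def intro!: gen_integral curve_continuous[OF c] continuous_intros)
  next
    case False
    then show ?thesis using gen_integral_U \<tau> by (simp add: w_def v_def)
  qed
  have vT: "v True \<in> E ?m" "N ?m (v True) \<le> B * (\<tau> * ?n)"
  proof -
    have "N ?m (exp (- t) *\<^sub>R U False t d) \<le> 2 ^ ?m * ((2 ^ ?m + 1) * ?n)" if t: "t \<in> {0..\<tau>}" for t
    proof -
      have "N ?m (exp (- t) *\<^sub>R U False t d) = exp (- t) * N ?m (U False t d)"
        using Ek_U[OF d(1), of t False] t \<tau> by (auto simp: Ek_scaleR)
      also have "\<dots> \<le> 1 * (2 ^ ?m * N ?m d)"
        using Ek_U[OF d(1), of t False] t \<tau> by (intro mult_mono) (auto simp: N_nonneg)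
      also have "\<dots> \<le> 2 ^ ?m * ((2 ^ ?m + 1) * ?n)"
        using d(2) by simp
      finally show ?thesis .
    qed
    from integral_Ek[OF c _ this] \<tau>
    have "v True \<in> E ?m" "N ?m (v True) \<le> 3 ^ ?m * (\<tau> * (2 ^ ?m * ((2 ^ ?m + 1) * ?n)))"
      by (auto simp: v_def)
    moreover have "3 ^ ?m * (\<tau> * (2 ^ ?m * ((2 ^ ?m + 1) * ?n))) = B * (\<tau> * ?n)"
    proof -
      have "(6::real) ^ ?m = 3 ^ ?m * 2 ^ ?m" by (simp flip: power_mult_distrib)
      then show ?thesis unfolding B_def by (simp only: ac_simps)
    qed
    ultimately show "v True \<in> E ?m" "N ?m (v True) \<le> B * (\<tau> * ?n)" by (simp_all only:)
  qed
  have vF: "v False \<in> E ?m" "N ?m (v False) \<le> B * (\<tau> * ?n)"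
  proof -
    have "N ?m (U False \<tau> h - h) \<le> (2 ^ ?m + 1) * N ?m h" "U False \<tau> h - h \<in> E ?m"
      using Ek_U[OF h(1), of \<tau> False] Ek_diff[of "U False \<tau> h" ?m h] h \<tau> by (auto simp: distrib_right)
    moreover have "(2 ^ ?m + 1) * N ?m h \<le> (2 ^ ?m + 1) * (6 ^ ?m * (\<tau> * ?n))"
      using h(2) by (intro mult_left_mono) auto
    ultimately show "v False \<in> E ?m" "N ?m (v False) \<le> B * (\<tau> * ?n)"
      unfolding v_def B_def mult.assoc if_False by (blast, linarith)
  qed
  have w: "w \<in> E (Suc ?m)" "N (Suc ?m) w = norm w + N ?m (v False) + N ?m (v True)"
    using Ek_SucI[of w v ?m, OF gw] vT(1) vF(1) by (metis (full_types))+
  have cu: "continuous_on {0..\<tau>} (\<lambda>s. U j s x)" for j x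
    by (intro continuous_intros)
  have nh: "norm h \<le> \<tau> * norm f"
    using integral_bound[of 0 \<tau> "\<lambda>s. U True s f" "norm f"] \<tau> U_norm cu
    by (auto simp: h_def mult.commute)
  \<comment> \<open>One of the two factors \<tau> is given up, using \<tau> \<le> 1, to match the
    bounds for the two generators; division by \<tau>^2 then leaves 1 / \<tau>.\<close>
  have "norm w \<le> \<tau> * norm h"
    using integral_bound[of 0 \<tau> "\<lambda>s. U False s h" "norm h"] \<tau> U_norm cu
    by (auto simp: w_def mult.commute)
  also have "\<dots> \<le> \<tau> * (1 * norm f)"
    using nh \<tau> mult_right_mono[of \<tau> 1 "norm f"] by (intro mult_left_mono) auto
  also have "\<dots> \<le> \<tau> * ?n"
    using \<tau> norm_le_N[of f ?m] by simp
  finally have "N (Suc ?m) w \<le> (1 + 2 * B) * (\<tau> * ?n)"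
    using w(2) vT(2) vF(2) by (simp add: algebra_simps)
  then have "(1 / \<tau>\<^sup>2) * N (Suc ?m) w \<le> (1 / \<tau>\<^sup>2) * ((1 + 2 * B) * (\<tau> * ?n))"
    by (intro mult_left_mono) auto
  also have "\<dots> = (1 + 2 * B) / \<tau> * ?n"
    using \<tau> by (simp add: power2_eq_square)
  finally have g: "g \<in> E (Suc ?m)" "N (Suc ?m) g \<le> (1 + 2 * B) / \<tau> * ?n"
    using Ek_scaleR[OF w(1), of "1 / \<tau>\<^sup>2"] by (auto simp: g_def)
  have avg: "integral {0..\<tau>} (\<lambda>s. U j s x - x) \<in> E k \<and>
      N k (integral {0..\<tau>} (\<lambda>s. U j s x - x)) \<le> 9 ^ k * (\<tau> * (\<tau> * N ?m x))" if x: "x \<in> E ?m" for j x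
  proof -
    have xk: "x \<in> E k" using x by (rule Ek_antimono[rotated]) simp
    have "N k (U j s x - x) \<le> 3 ^ k * (\<tau> * N ?m x)" if s: "s \<in> {0..\<tau>}" for s
    proof -
      have "N k (U j s x - x) \<le> 3 ^ k * (s * N ?m x)" using N_U_diff[OF x, of s j] s \<tau> by (simp add: ac_simps)
      also have "\<dots> \<le> 3 ^ k * (\<tau> * N ?m x)" using s by (intro mult_left_mono mult_right_mono) (auto simp: N_nonneg)
      finally show ?thesis .
    qed
    moreover have "curve k \<tau> (\<lambda>s. U j s x - x)"
      using curve_add[OF curve_U[OF xk] curve_const[of "(-1) *\<^sub>R x"]] Ek_scaleR[OF xk, of "-1"] by simp
    moreover have "(9::real) ^ k = 3 ^ k * 3 ^ k" by (simp flip: power_mult_distrib)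
    ultimately show ?thesis using integral_Ek[of k \<tau> "\<lambda>s. U j s x - x" "3 ^ k * (\<tau> * N ?m x)"] \<tau>
      by (simp add: ac_simps)
  qed
  \<comment> \<open>The error is split in two stages: f against h / \<tau>, then h against w /
    \<tau>. Each is an average of increments, of order \<tau>.\<close>
  define e1 where "e1 = integral {0..\<tau>} (\<lambda>s. U True s f - f)"
  define e2 where "e2 = integral {0..\<tau>} (\<lambda>s. U False s h - h)"
  have "integral {0..\<tau>} (\<lambda>s. U j s x - x) = integral {0..\<tau>} (\<lambda>s. U j s x) - \<tau> *\<^sub>R x" for j x
    using integral_diff[OF int[of j x] integrable_const_ivl[of x 0 \<tau>]] \<tau> by simp
  then have e12: "e1 = h - \<tau> *\<^sub>R f" "e2 = w - \<tau> *\<^sub>R h"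
    by (simp_all only: e1_def e2_def w_def h_def[symmetric])
  have e1: "e1 \<in> E k" "N k e1 \<le> 9 ^ k * (\<tau> * (\<tau> * ?n))"
    using avg[OF f, of True] by (auto simp: e1_def)
  have "e2 \<in> E k" "N k e2 \<le> 9 ^ k * (\<tau> * (\<tau> * N ?m h))"
    using avg[OF h(1), of False] by (auto simp: e2_def)
  moreover have "9 ^ k * (\<tau> * (\<tau> * N ?m h)) \<le> 9 ^ k * (\<tau> * (\<tau> * (6 ^ ?m * (\<tau> * ?n))))"
    using \<tau> h(2) by (intro mult_left_mono) auto
  ultimately have e2: "e2 \<in> E k" "N k e2 \<le> 9 ^ k * (\<tau> * (\<tau> * (6 ^ ?m * (\<tau> * ?n))))" by (blast, linarith)
  have eq: "f - g = (- (1 / \<tau>)) *\<^sub>R e1 + (- (1 / \<tau>\<^sup>2)) *\<^sub>R e2"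
    using \<tau> by (simp add: e12 g_def scaleR_diff_right power2_eq_square)
  have "N k (f - g) \<le> N k ((- (1 / \<tau>)) *\<^sub>R e1) + N k ((- (1 / \<tau>\<^sup>2)) *\<^sub>R e2)"
    unfolding eq using Ek_add Ek_scaleR e1(1) e2(1) by blast
  also have "\<dots> = 1 / \<tau> * N k e1 + 1 / \<tau>\<^sup>2 * N k e2"
    using Ek_scaleR[OF e1(1), of "- (1 / \<tau>)"] Ek_scaleR[OF e2(1), of "- (1 / \<tau>\<^sup>2)"] \<tau> by simp
  also have "\<dots> \<le> 1 / \<tau> * (9 ^ k * (\<tau> * (\<tau> * ?n))) + 1 / \<tau>\<^sup>2 * (9 ^ k * (\<tau> * (\<tau> * (6 ^ ?m * (\<tau> * ?n)))))"
    using e1 e2 \<tau> by (intro add_mono mult_left_mono) auto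
  also have "\<dots> = 9 ^ k * (1 + 6 ^ ?m) * \<tau> * ?n"
    using \<tau> by (simp add: power2_eq_square algebra_simps)
  finally show ?thesis using g by blast
qed

section \<open>The K-functional: elementary properties and the approximation estimate\<close>

abbreviation "K \<equiv> K_functional T"

lemma K_bdd_below:
  "0 \<le> t \<Longrightarrow> bdd_below {N k1 f0 + t * N k2 f1 | f0 f1. f0 \<in> E k1 \<and> f1 \<in> E k2 \<and> f = f0 + f1}"
  by (rule bdd_belowI[of _ 0]) (auto simp: N_nonneg)

lemma K_le:
  "f0 \<in> E k1 \<Longrightarrow> f1 \<in> E k2 \<Longrightarrow> 0 \<le> t \<Longrightarrow> K k1 k2 t (f0 + f1) \<le> N k1 f0 + t * N k2 f1"
  unfolding K_functional_def by (rule cInf_lower[OF _ K_bdd_below]) auto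

lemma K_greatest:
  assumes "f \<in> E k1"
    and "\<And>f0 f1. f0 \<in> E k1 \<Longrightarrow> f1 \<in> E k2 \<Longrightarrow> f = f0 + f1 \<Longrightarrow> c \<le> N k1 f0 + t * N k2 f1"
  shows "c \<le> K k1 k2 t f"
  unfolding K_functional_def
proof (rule cInf_greatest)
  have "f = f + 0" by simp
  then show "{N k1 f0 + t * N k2 f1 |f0 f1. f0 \<in> E k1 \<and> f1 \<in> E k2 \<and> f = f0 + f1} \<noteq> {}"
    using assms(1) Ek_zero(1)[of k2] by blast
qed (use assms(2) in auto)

lemma K_approx:
  assumes "f \<in> E k1" "K k1 k2 t f < c"
  obtains f0 f1 where "f0 \<in> E k1" "f1 \<in> E k2" "f = f0 + f1" "N k1 f0 + t * N k2 f1 < c"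
  using K_greatest[OF assms(1), of k2 c t] assms(2) by force

lemma K_nonneg: "f \<in> E k1 \<Longrightarrow> 0 \<le> t \<Longrightarrow> 0 \<le> K k1 k2 t f"
  by (rule K_greatest) (auto simp: N_nonneg)

lemma K_le_N: "f \<in> E k1 \<Longrightarrow> 0 \<le> t \<Longrightarrow> K k1 k2 t f \<le> N k1 f"
  using K_le[of f k1 0 k2 t] by simp

lemma K_le_N': "f \<in> E k2 \<Longrightarrow> 0 \<le> t \<Longrightarrow> K k1 k2 t f \<le> t * N k2 f"
  using K_le[of 0 k1 f k2 t] by simp

lemma K_add:
  assumes f: "f \<in> E k1" and g: "g \<in> E k1" and t: "0 \<le> t"
  shows "K k1 k2 t (f + g) \<le> K k1 k2 t f + K k1 k2 t g"
proof -
  have "K k1 k2 t (f + g) - K k1 k2 t g \<le> N k1 f0 + t * N k2 f1"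
    if fd: "f0 \<in> E k1" "f1 \<in> E k2" "f = f0 + f1" for f0 f1
  proof -
    have "K k1 k2 t (f + g) - (N k1 f0 + t * N k2 f1) \<le> K k1 k2 t g"
    proof (rule K_greatest[OF g])
      fix g0 g1 assume gd: "g0 \<in> E k1" "g1 \<in> E k2" "g = g0 + g1"
      have "f + g = (f0 + g0) + (f1 + g1)" using fd gd by simp
      then have "K k1 k2 t (f + g) \<le> N k1 (f0 + g0) + t * N k2 (f1 + g1)"
        using K_le Ek_add fd gd t by metis
      also have "\<dots> \<le> (N k1 f0 + N k1 g0) + t * (N k2 f1 + N k2 g1)"
        using Ek_add fd gd t by (intro add_mono mult_left_mono) auto
      finally show "K k1 k2 t (f + g) - (N k1 f0 + t * N k2 f1) \<le> N k1 g0 + t * N k2 g1"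
        by (simp add: algebra_simps)
    qed
    then show ?thesis by simp
  qed
  then have "K k1 k2 t (f + g) - K k1 k2 t g \<le> K k1 k2 t f"
    by (rule K_greatest[OF f])
  then show ?thesis by simp
qed

lemma K_mono:
  assumes f: "f \<in> E k1" and t: "0 \<le> s" "s \<le> t"
  shows "K k1 k2 s f \<le> K k1 k2 t f"
proof (rule K_greatest[OF f])
  fix f0 f1 assume d: "f0 \<in> E k1" "f1 \<in> E k2" "f = f0 + f1"
  have "K k1 k2 s f \<le> N k1 f0 + s * N k2 f1" using K_le d t by blast
  also have "\<dots> \<le> N k1 f0 + t * N k2 f1" using t by (intro add_mono mult_right_mono) (auto simp: N_nonneg)
  finally show "K k1 k2 s f \<le> N k1 f0 + t * N k2 f1" .
qed

lemma K_mult_le: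
  assumes f: "f \<in> E k1" and t: "0 \<le> t" "1 \<le> c"
  shows "K k1 k2 (c * t) f \<le> c * K k1 k2 t f"
proof -
  have "K k1 k2 (c * t) f / c \<le> K k1 k2 t f"
  proof (rule K_greatest[OF f])
    fix f0 f1 assume d: "f0 \<in> E k1" "f1 \<in> E k2" "f = f0 + f1"
    have "K k1 k2 (c * t) f \<le> N k1 f0 + (c * t) * N k2 f1" using K_le[OF d(1,2), of "c * t"] d t by simp
    also have "\<dots> \<le> c * N k1 f0 + (c * t) * N k2 f1"
      using t mult_right_mono[OF t(2) N_nonneg[of k1 f0]] by simp
    finally show "K k1 k2 (c * t) f / c \<le> N k1 f0 + t * N k2 f1"
      using t by (simp add: pos_divide_le_eq algebra_simps)
  qed
  then show ?thesis using t by (simp add: pos_divide_le_eq mult.commute)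
qed

text \<open>Average f at scale c \<tau>. The error f - g is small in E^m, so the estimate known at
  level m + 1 splits it as a + b with \<open>a\<close> small in E and \<open>b\<close> at most half
  as large as f in E^(m+1). Then a + g is a good competitor at level m + 2. In \<open>L\<close>, 1/2
  comes from \<open>a\<close> and the other term from g.\<close>

lemma K_approximation_step:
  assumes C: "C > 0"
    and le: "\<And>k f. k \<le> Suc m \<Longrightarrow> f \<in> E k \<Longrightarrow> K 0 (Suc m) (\<tau> ^ Suc m) f \<le> C * \<tau> ^ k * N k f"
    and \<tau>: "0 < \<tau>" "\<tau> \<le> 1" and f: "f \<in> E (Suc m)"
    and c: "0 < c" "c \<le> 1" "C * (9 ^ m * (1 + 6 ^ Suc m)) * c \<le> 1 / 4"
    and L: "L = 1 / 2 + (1 + 2 * ((2 ^ Suc m + 1) * 6 ^ Suc m)) / c"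
  shows "\<exists>b\<in>E (Suc m). N (Suc m) b \<le> N (Suc m) f / 2 \<and>
    K 0 (Suc (Suc m)) (\<tau> ^ Suc (Suc m)) f \<le>
      L * \<tau> ^ Suc m * N (Suc m) f + K 0 (Suc (Suc m)) (\<tau> ^ Suc (Suc m)) b"
proof (cases "f = 0")
  case True
  have "K 0 (Suc (Suc m)) (\<tau> ^ Suc (Suc m)) 0 \<le> 0"
    using K_le_N[of 0 0 "\<tau> ^ Suc (Suc m)" "Suc (Suc m)"] \<tau> by simp
  then show ?thesis using True by (intro bexI[of _ 0]) auto
next
  case False
  let ?n = "N (Suc m) f" and ?t = "\<tau> ^ Suc m" and ?B = "1 + 2 * ((2 ^ Suc m + 1) * 6 ^ Suc m)"
  have n: "?n > 0" using norm_le_N[of f "Suc m"] False by (smt (verit) zero_less_norm_iff)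
  have t: "?t > 0" using \<tau> by simp
  obtain g where g: "g \<in> E (Suc (Suc m))" "N (Suc (Suc m)) g \<le> ?B / (c * \<tau>) * ?n"
    "N m (f - g) \<le> 9 ^ m * (1 + 6 ^ Suc m) * (c * \<tau>) * ?n"
    using averaging[OF f, of "c * \<tau>"] c \<tau> by (auto simp: mult_le_one)
  have gm: "g \<in> E (Suc m)" using g(1) by (rule Ek_antimono[rotated]) simp
  have fg: "f - g \<in> E m" using f gm by (intro Ek_antimono[of m "Suc m"]) (auto simp: Ek_diff)
  have "K 0 (Suc m) ?t (f - g) \<le> C * \<tau> ^ m * N m (f - g)"
    by (intro le fg) simp
  also have "\<dots> \<le> C * \<tau> ^ m * (9 ^ m * (1 + 6 ^ Suc m) * (c * \<tau>) * ?n)"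
    using C \<tau> g(3) by (intro mult_left_mono) auto
  also have "\<dots> = (C * (9 ^ m * (1 + 6 ^ Suc m)) * c) * (?t * ?n)"
    by (simp add: ac_simps)
  also have "\<dots> \<le> 1 / 4 * (?t * ?n)"
    using c n t by (intro mult_right_mono) auto
  \<comment> \<open>The strict gap between 1/4 and 1/2 allows a decomposition that is only nearly
    optimal; it needs ?n > 0, whence the separate case f = 0.\<close>
  also have "\<dots> < 1 / 2 * (?t * ?n)"
    using mult_pos_pos[OF t n] by linarith
  finally obtain a b where ab: "b \<in> E (Suc m)" "f - g = a + b" "norm a + ?t * N (Suc m) b < 1 / 2 * (?t * ?n)"
    using K_approx[of "f - g" 0 "Suc m" ?t] by (metis Ek_0 N_0)
  have a: "norm a \<le> 1 / 2 * (?t * ?n)"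
    using ab(3) mult_nonneg_nonneg[OF less_imp_le[OF t] N_nonneg[of "Suc m" b]] by linarith
  have "?t * N (Suc m) b \<le> ?t * (?n / 2)"
    using ab(3) norm_ge_zero[of a] by linarith
  then have b: "N (Suc m) b \<le> ?n / 2" using t by (rule mult_left_le_imp_le)
  let ?K = "K 0 (Suc (Suc m)) (\<tau> ^ Suc (Suc m))"
  have "?K f = ?K ((a + g) + b)" using ab(2) by (simp add: algebra_simps)
  also have "\<dots> \<le> ?K (a + g) + ?K b"
    using \<tau> by (intro K_add) auto
  also have "?K (a + g) \<le> norm a + \<tau> ^ Suc (Suc m) * N (Suc (Suc m)) g"
    using K_le[of a 0 g "Suc (Suc m)"] g \<tau> by simp
  also have "\<dots> \<le> 1 / 2 * (?t * ?n) + \<tau> ^ Suc (Suc m) * (?B / (c * \<tau>) * ?n)"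
    using \<tau> by (intro add_mono a mult_left_mono g(2)) auto
  also have "\<tau> ^ Suc (Suc m) * (?B / (c * \<tau>) * ?n) = ?B / c * (?t * ?n)"
    using \<tau> by simp
  also have "1 / 2 * (?t * ?n) + ?B / c * (?t * ?n) = L * ?t * ?n"
    by (simp only: L distrib_right mult.assoc)
  finally have "?K f \<le> L * ?t * ?n + ?K b" by simp
  then show ?thesis using ab(1) b by blast
qed

text \<open>For level r + 1 the decisive case is k = r, obtained by iterating the step. For other k
  \<le> r, f is split at level r and the case k = r is applied to the smooth part.\<close>

lemma K_approximation_aux:
  "\<exists>C>0. \<forall>\<tau>. 0 < \<tau> \<longrightarrow> \<tau> \<le> 1 \<longrightarrow> (\<forall>k\<le>r. \<forall>f\<in>E k. K 0 r (\<tau> ^ r) f \<le> C * \<tau> ^ k * N k f)"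
proof (induction r)
  case 0
  show ?case using K_le_N[of _ 0 1 0] by (intro exI[of _ 1]) auto
next
  case (Suc r)
  then obtain C where C: "C > 0"
    and le: "\<And>\<tau> k f. 0 < \<tau> \<Longrightarrow> \<tau> \<le> 1 \<Longrightarrow> k \<le> r \<Longrightarrow> f \<in> E k \<Longrightarrow> K 0 r (\<tau> ^ r) f \<le> C * \<tau> ^ k * N k f"
    by blast
  obtain D where D: "D > 0"
    and Dle: "\<And>\<tau> f. 0 < \<tau> \<Longrightarrow> \<tau> \<le> 1 \<Longrightarrow> f \<in> E r \<Longrightarrow> K 0 (Suc r) (\<tau> ^ Suc r) f \<le> D * \<tau> ^ r * N r f"
  proof (cases r)
    case 0
    show ?thesis
    proof (rule that[of 1])
      fix \<tau> :: real and f assume "0 < \<tau>" "f \<in> E r"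
      then show "K 0 (Suc r) (\<tau> ^ Suc r) f \<le> 1 * \<tau> ^ r * N r f"
        using K_le_N[of f 0 \<tau> "Suc 0"] 0 by simp
    qed simp
  next
    case r: (Suc m)
    define P where "P = C * (9 ^ m * (1 + 6 ^ Suc m))"
    define c where "c = 1 / (4 * P + 1)"
    define L where "L = 1 / 2 + (1 + 2 * ((2 ^ Suc m + 1) * 6 ^ Suc m)) / c"
    have P: "0 < P" unfolding P_def using C by (simp add: add_pos_pos)
    have c: "0 < c" "c \<le> 1" "C * (9 ^ m * (1 + 6 ^ Suc m)) * c \<le> 1 / 4"
      unfolding P_def[symmetric] using P by (auto simp: c_def field_simps)
    have L: "L > 0" unfolding L_def using c(1)
      by (intro add_pos_pos divide_pos_pos mult_pos_pos zero_less_power) simp_all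
    show ?thesis
    proof (rule that[of "2 * L"])
      fix \<tau> :: real and f assume t: "0 < \<tau>" "\<tau> \<le> 1" and f: "f \<in> E r"
      let ?K = "K 0 (Suc r) (\<tau> ^ Suc r)"
      \<comment> \<open>2 L is the fixed point of X = L + X / 2, since the remainder is halved each
        time. Only the numbers ?K f are iterated, so no series of vectors has to converge.\<close>
      have it: "?K f \<le> (2 * L * \<tau> ^ r + (1 / 2) ^ n) * N r f" if "f \<in> E r" for n f
        using that
      proof (induction n arbitrary: f)
        case 0
        have "?K f \<le> N r f" using K_le_N[of f 0 "\<tau> ^ Suc r" "Suc r"] norm_le_N[of f r] t by simp
        also have "\<dots> \<le> (2 * L * \<tau> ^ r + 1) * N r f"
          using L t mult_right_mono[of 1 "2 * L * \<tau> ^ r + 1" "N r f"] by (simp add: N_nonneg)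
        finally show ?case by simp
      next
        case (Suc n)
        obtain b where b: "b \<in> E r" "N r b \<le> N r f / 2" "?K f \<le> L * \<tau> ^ r * N r f + ?K b"
          using K_approximation_step[OF C le[OF t, unfolded r] t Suc.prems[unfolded r] c L_def]
          unfolding r by blast
        note b(3)
        also have "?K b \<le> (2 * L * \<tau> ^ r + (1 / 2) ^ n) * N r b" by (rule Suc.IH[OF b(1)])
        also have "\<dots> \<le> (2 * L * \<tau> ^ r + (1 / 2) ^ n) * (N r f / 2)"
          using L t b(2) by (intro mult_left_mono) auto
        finally show ?case by (simp add: algebra_simps)
      qed
      show "?K f \<le> 2 * L * \<tau> ^ r * N r f"
      proof (rule LIMSEQ_le_const)
        show "(\<lambda>n. (2 * L * \<tau> ^ r + (1 / 2) ^ n) * N r f) \<longlonglongrightarrow> 2 * L * \<tau> ^ r * N r f"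
          by (auto intro!: tendsto_eq_intros LIMSEQ_realpow_zero)
      qed (use it[OF f] in auto)
    qed (use L in simp)
  qed
  show ?case
  proof (intro exI[of _ "1 + 2 * C + 2 * C * D"] conjI allI impI ballI)
    show "0 < 1 + 2 * C + 2 * C * D" using C D by (simp add: add_pos_pos)
    fix \<tau> :: real and k f assume t: "0 < \<tau>" "\<tau> \<le> 1" and k: "k \<le> Suc r" and f: "f \<in> E k"
    let ?K = "K 0 (Suc r) (\<tau> ^ Suc r)"
    have Z: "0 \<le> \<tau> ^ k * N k f" using t N_nonneg by simp
    consider "f = 0" | "k = Suc r" | "f \<noteq> 0" "k \<le> r" using k by linarith
    then have "?K f \<le> (1 + 2 * C + 2 * C * D) * (\<tau> ^ k * N k f)"
    proof cases
      case 1
      then show ?thesis using K_le_N[of 0 0 "\<tau> ^ Suc r" "Suc r"] t by simp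
    next
      case 2
      have "?K f \<le> 1 * (\<tau> ^ k * N k f)" using K_le_N'[of f "Suc r" "\<tau> ^ Suc r" 0] f t 2 by simp
      also have "\<dots> \<le> (1 + 2 * C + 2 * C * D) * (\<tau> ^ k * N k f)"
        using C D Z by (intro mult_right_mono) auto
      finally show ?thesis .
    next
      case 3
      \<comment> \<open>Twice the known bound, so that a decomposition below it exists although the
        infimum may not be attained.\<close>
      let ?M = "2 * C * (\<tau> ^ k * N k f)"
      have "N k f > 0" using norm_le_N[of f k] 3 by (smt (verit) zero_less_norm_iff)
      then have "K 0 r (\<tau> ^ r) f < ?M"
        using le[OF t 3(2) f] C t by (intro le_less_trans[OF le[OF t 3(2) f]]) simp
      then obtain f0 f1 where d: "f1 \<in> E r" "f = f0 + f1" "norm f0 + \<tau> ^ r * N r f1 < ?M"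
        using K_approx[of f 0 r "\<tau> ^ r"] by (metis Ek_0 N_0)
      have le1: "norm f0 \<le> ?M" "\<tau> ^ r * N r f1 \<le> ?M"
        using d(3) mult_nonneg_nonneg[OF zero_le_power[of \<tau> r] N_nonneg[of r f1]] t norm_ge_zero[of f0] by linarith+
      have "?K f \<le> ?K f0 + ?K f1" unfolding d(2) using t by (intro K_add) auto
      also have "\<dots> \<le> norm f0 + D * \<tau> ^ r * N r f1"
        using K_le_N[of f0 0 "\<tau> ^ Suc r" "Suc r"] t Dle[OF t d(1)] by (intro add_mono) auto
      also have "\<dots> \<le> ?M + D * ?M"
        using le1 mult_left_mono[OF le1(2) less_imp_le[OF D]] by (simp add: mult.assoc)
      also have "\<dots> = (2 * C + 2 * C * D) * (\<tau> ^ k * N k f)" by (simp add: algebra_simps)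
      also have "\<dots> \<le> (1 + 2 * C + 2 * C * D) * (\<tau> ^ k * N k f)"
        using Z by (intro mult_right_mono) auto
      finally show ?thesis .
    qed
    then show "?K f \<le> (1 + 2 * C + 2 * C * D) * \<tau> ^ k * N k f" by (simp add: mult.assoc)
  qed
qed

lemma K_approximation:
  obtains C where "C > 0"
    "\<And>\<tau> k f. 0 < \<tau> \<Longrightarrow> k \<le> r \<Longrightarrow> f \<in> E k \<Longrightarrow> K 0 r (\<tau> ^ r) f \<le> C * \<tau> ^ k * N k f"
proof -
  obtain C where C: "C > 0"
    and le: "\<And>\<tau> k f. 0 < \<tau> \<Longrightarrow> \<tau> \<le> 1 \<Longrightarrow> k \<le> r \<Longrightarrow> f \<in> E k \<Longrightarrow> K 0 r (\<tau> ^ r) f \<le> C * \<tau> ^ k * N k f"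
    using K_approximation_aux[of r] by blast
  show ?thesis
  proof (rule that[of "C + 1"])
    fix \<tau> :: real and k f assume t: "0 < \<tau>" and k: "k \<le> r" and f: "f \<in> E k"
    have Z: "0 \<le> \<tau> ^ k * N k f" using t N_nonneg by simp
    have "K 0 r (\<tau> ^ r) f \<le> (C + 1) * (\<tau> ^ k * N k f)"
    proof (cases "\<tau> \<le> 1")
      case True
      then show ?thesis using le[OF t True k f] Z by (simp add: distrib_right mult.assoc)
    next
      case False
      have "K 0 r (\<tau> ^ r) f \<le> 1 * norm f" using K_le_N[of f 0 "\<tau> ^ r" r] t by simp
      also have "\<dots> \<le> \<tau> ^ k * N k f"
        using False norm_le_N by (intro mult_mono one_le_power) auto
      also have "\<dots> \<le> (C + 1) * (\<tau> ^ k * N k f)"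
        using C Z mult_right_mono[of 1 "C + 1" "\<tau> ^ k * N k f"] by simp
      finally show ?thesis .
    qed
    then show "K 0 r (\<tau> ^ r) f \<le> (C + 1) * \<tau> ^ k * N k f" by (simp add: mult.assoc)
  qed (use C in simp)
qed

section \<open>Series in the spaces \<open>E k\<close>\<close>

lemma gen_sum:
  assumes "\<And>i. i < (n::nat) \<Longrightarrow> gen j (u i) (v i)"
  shows "gen j (\<Sum>i<n. u i) (\<Sum>i<n. v i)"
  using assms
proof (induction n)
  case 0
  have "gen j 0 (A j 0)" by (rule Ek_SucD(1)[of 0 0]) (rule Ek_zero)
  from gen_scaleR[OF this, of 0] show ?case by simp
next
  case (Suc n)
  then show ?case by (auto intro!: gen_add)
qed

text \<open>Completeness of \<open>E k\<close> for absolutely convergent series: closedness, applied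
  to the partial sums, lets each generator act termwise, and the induction runs over the
  order.\<close>

lemma Ek_suminf:
  assumes "\<And>n. u n \<in> E k" "summable (\<lambda>n. N k (u n))"
  shows "suminf u \<in> E k \<and> N k (suminf u) \<le> (\<Sum>n. N k (u n))"
  using assms
proof (induction k arbitrary: u)
  case 0
  then show ?case by (simp add: summable_norm)
next
  case (Suc k)
  note u = Ek_SucD[OF Suc.prems(1)]
  have sn: "summable (\<lambda>n. norm (u n))"
    by (rule summable_comparison_test'[OF Suc.prems(2)]) (simp add: norm_le_N)
  have sA: "summable (\<lambda>n. N k (A j (u n)))" for j
    by (rule summable_comparison_test'[OF Suc.prems(2)]) (simp add: N_A_le[OF Suc.prems(1)] N_nonneg)
  have sAn: "summable (\<lambda>n. A j (u n))" for j
    by (rule summable_norm_cancel, rule summable_comparison_test'[OF sA[of j]]) (simp add: norm_le_N)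
  note IH = Suc.IH[OF u(2) sA]
  have g: "gen j (suminf u) (\<Sum>n. A j (u n))" for j
    by (rule gen_closed[OF summable_LIMSEQ[OF summable_norm_cancel[OF sn]] summable_LIMSEQ[OF sAn]])
      (rule gen_sum[OF u(1)])
  have "(\<Sum>n. N (Suc k) (u n)) = (\<Sum>n. norm (u n) + N k (A False (u n)) + N k (A True (u n)))"
    by (simp add: N_Suc[OF Suc.prems(1)])
  also have "\<dots> = (\<Sum>n. norm (u n)) + (\<Sum>n. N k (A False (u n))) + (\<Sum>n. N k (A True (u n)))"
    by (simp add: suminf_add[symmetric] sn sA summable_add)
  finally show ?case
    using Ek_SucI[OF g, of k] IH summable_norm[OF sn] by (auto intro!: add_mono)
qed

section \<open>Reiteration\<close>

text \<open>This is t^(-\<theta>) K(t, f) at t = exp ((k2 - k1) x) with \<theta> = (\<alpha> - k1) /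
  (k2 - k1). For every couple x is the logarithm of the same scale, so different couples can be
  compared pointwise.\<close>

definition rescaled_K where
  "rescaled_K k1 k2 \<alpha> f x = exp (- (\<alpha> - real k1) * x) * K k1 k2 (exp ((real k2 - real k1) * x)) f"

lemma rescaled_K_nonneg: "f \<in> E k1 \<Longrightarrow> 0 \<le> rescaled_K k1 k2 \<alpha> f x"
  by (simp add: rescaled_K_def K_nonneg)

text \<open>Monotonicity is available for t \<ge> 0; cutting off at 0 makes the function monotone on
  the whole line, hence Borel.\<close>

lemma K_measurable: "f \<in> E k1 \<Longrightarrow> (\<lambda>t. K k1 k2 (max 0 t) f) \<in> borel_measurable borel"
  by (rule borel_measurable_mono) (auto intro!: monoI K_mono)

lemma rescaled_K_measurable:
  assumes "f \<in> E k1"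
  shows "rescaled_K k1 k2 \<alpha> f \<in> borel_measurable borel"
proof -
  note [measurable] = K_measurable[OF assms, of k2]
  have eq: "rescaled_K k1 k2 \<alpha> f =
      (\<lambda>x. exp (- (\<alpha> - real k1) * x) * K k1 k2 (max 0 (exp ((real k2 - real k1) * x))) f)"
    by (simp add: rescaled_K_def fun_eq_iff max_absorb2)
  show ?thesis unfolding eq by measurable
qed

lemma interp_norm_eq_Lq_norm:
  assumes f: "f \<in> E k1" and k: "k1 < k2"
  shows "interp_norm T k1 k2 ((\<alpha> - real k1) / (real k2 - real k1)) q f =
    Lq_norm (real k2 - real k1) q (rescaled_K k1 k2 \<alpha> f)"
proof -
  define m where "m = real k2 - real k1"
  define \<theta> where "\<theta> = (\<alpha> - real k1) / m"
  have m: "m > 0" using k by (simp add: m_def)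
  have e: "exp (m * x) powr (- \<theta>) * K k1 k2 (exp (m * x)) f = rescaled_K k1 k2 \<alpha> f x" for x
  proof -
    have "m * \<theta> = \<alpha> - real k1" using m by (simp add: \<theta>_def)
    then have "m * x * (- \<theta>) = - (\<alpha> - real k1) * x" by (metis mult.assoc mult.commute mult_minus_left)
    then show ?thesis by (simp only: rescaled_K_def m_def[symmetric] exp_powr_real)
  qed
  show ?thesis
  proof (cases "q = \<infinity>")
    case True
    have "{0<..} = range (\<lambda>x. exp (m * x))"
    proof (intro subset_antisym subsetI)
      fix t :: real assume "t \<in> {0<..}"
      then have "t = exp (m * (ln t / m))" using m by simp
      then show "t \<in> range (\<lambda>x. exp (m * x))" by blast
    qed auto
    then show ?thesis
      using True e by (simp add: interp_norm_def Lq_norm_def image_image m_def[symmetric] \<theta>_def[symmetric])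
  next
    case False
    define p where "p = real_of_ereal q"
    note [measurable] = K_measurable[OF f, of k2]
    define h where "h t = (t powr (- \<theta>) * K k1 k2 (max 0 t) f) powr p" for t
    have [measurable]: "h \<in> borel_measurable borel" unfolding h_def[abs_def] by measurable
    have "(\<integral>\<^sup>+t. indicator {0<..} t * ennreal ((t powr (- \<theta>) * K k1 k2 t f) powr p / t) \<partial>lborel) =
        (\<integral>\<^sup>+t. indicator {0<..} t * ennreal (h t / t) \<partial>lborel)"
      by (intro nn_integral_cong) (auto simp: h_def indicator_def)
    also have "\<dots> = ennreal m * (\<integral>\<^sup>+x. ennreal (h (exp (m * x))) \<partial>lborel)"
      by (rule nn_integral_powr_substitution[OF _ m]) simp
    also have "(\<lambda>x. h (exp (m * x))) = (\<lambda>x. rescaled_K k1 k2 \<alpha> f x powr p)"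
      by (simp add: h_def e max_absorb2)
    finally show ?thesis
      using False by (simp add: interp_norm_def Lq_norm_def ennroot_def Let_def p_def[symmetric] m_def[symmetric] \<theta>_def[symmetric])
  qed
qed

text \<open>K is nondecreasing, so on [x, x + 1] the function stays above exp (-(\<alpha> - k1))
  times its value at x. The integral over this unit interval therefore controls the value. The bound
  secures the convergence of the later series.\<close>

lemma rescaled_K_bounded:
  assumes f: "f \<in> E k1" and \<alpha>: "real k1 < \<alpha>" and k: "k1 \<le> k2" and m: "0 < m" and q: "1 \<le> q"
    and fin: "Lq_norm m q (rescaled_K k1 k2 \<alpha> f) < \<infinity>"
  obtains M where "\<And>x. rescaled_K k1 k2 \<alpha> f x \<le> M"
proof (cases "q = \<infinity>")
  case True
  then obtain b where b: "(SUP x. ennreal (rescaled_K k1 k2 \<alpha> f x)) = ennreal b" "0 \<le> b"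
    using fin by (cases "SUP x. ennreal (rescaled_K k1 k2 \<alpha> f x)") (auto simp: Lq_norm_def)
  have "ennreal (rescaled_K k1 k2 \<alpha> f x) \<le> ennreal b" for x
    unfolding b(1)[symmetric] by (rule SUP_upper) simp
  then show ?thesis using b(2) by (intro that[of b]) simp
next
  case False
  define p where "p = real_of_ereal q"
  have p: "1 \<le> p" using q False by (cases q) (auto simp: p_def)
  let ?F = "rescaled_K k1 k2 \<alpha> f"
  define J where "J = (\<integral>\<^sup>+x. ennreal (?F x powr p) \<partial>lborel)"
  have "ennreal m * J < \<infinity>"
    using fin False by (simp add: Lq_norm_def ennroot_less_top_iff[unfolded infinity_ennreal_def] J_def p_def)
  then have "J < \<infinity>" using m by (auto simp: ennreal_mult_less_top)
  then obtain b where b: "J = ennreal b" "0 \<le> b" by (cases J) auto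
  define a where "a = \<alpha> - real k1"
  have "?F x \<le> exp a * b powr (1 / p)" for x
  proof -
    let ?c = "exp (- a) * ?F x"
    have c0: "0 \<le> ?c" by (simp add: rescaled_K_nonneg f)
    have le: "?c \<le> ?F y" if y: "y \<in> {x..x+1}" for y
    proof -
      have "?c = exp (- a - a * x) * K k1 k2 (exp ((real k2 - real k1) * x)) f"
        unfolding rescaled_K_def a_def[symmetric] by (simp add: mult.assoc[symmetric] flip: exp_add)
      also have "\<dots> \<le> exp (- a * y) * K k1 k2 (exp ((real k2 - real k1) * y)) f"
      proof (intro mult_mono K_mono f)
        have "a * y \<le> a * (x + 1)" using y \<alpha> by (intro mult_left_mono) (auto simp: a_def)
        then show "exp (- a - a * x) \<le> exp (- a * y)" by (simp add: algebra_simps)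
      qed (use y k f in \<open>auto intro!: mult_left_mono K_nonneg\<close>)
      finally show ?thesis by (simp add: rescaled_K_def a_def)
    qed
    have "ennreal (?c powr p) = (\<integral>\<^sup>+y. ennreal (?c powr p) * indicator {x..x+1} y \<partial>lborel)"
      by (simp add: nn_integral_cmult_indicator)
    also have "\<dots> \<le> J"
      unfolding J_def using p c0
      by (intro nn_integral_mono) (auto simp: indicator_def intro!: ennreal_leI powr_mono2 le)
    finally have "?c powr p \<le> b" using b by simp
    then have "(?c powr p) powr (1 / p) \<le> b powr (1 / p)"
      using p by (intro powr_mono2) auto
    then have "?c \<le> b powr (1 / p)" using p c0 by (simp add: powr_powr)
    then have "exp a * ?c \<le> exp a * b powr (1 / p)" by (intro mult_left_mono) auto
    then show ?thesis by (simp add: mult.assoc[symmetric] flip: exp_add)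
  qed
  then show ?thesis by (rule that)
qed

lemma exp_of_nat_mult_power: "exp (real n * y) = exp y ^ n"
  by (simp add: exp_of_nat_mult)

text \<open>For any competitor f0 + f1 of the couple (E^k1, E^k2), the approximation estimate is
  applied to f0 with k = k1 and to f1 with k = k2; the powers of exp x combine to the parameter of
  that couple.\<close>

lemma rescaled_K_0_le:
  assumes k: "k1 \<le> k2" "k2 \<le> r"
  obtains C where "0 < C"
    "\<And>f x. f \<in> E k1 \<Longrightarrow> rescaled_K 0 r \<alpha> f x \<le> C * rescaled_K k1 k2 \<alpha> f x"
proof -
  obtain C where C: "C > 0"
    and le: "\<And>\<tau> k f. 0 < \<tau> \<Longrightarrow> k \<le> r \<Longrightarrow> f \<in> E k \<Longrightarrow> K 0 r (\<tau> ^ r) f \<le> C * \<tau> ^ k * N k f"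
    using K_approximation[of r] by blast
  show ?thesis
  proof (rule that[OF C])
    fix f x assume f: "f \<in> E k1"
    let ?t = "exp ((real k2 - real k1) * x)"
    have "K 0 r (exp x ^ r) f / (C * exp x ^ k1) \<le> K k1 k2 ?t f"
    proof (rule K_greatest[OF f])
      fix f0 f1 assume d: "f0 \<in> E k1" "f1 \<in> E k2" "f = f0 + f1"
      have "K 0 r (exp x ^ r) f \<le> K 0 r (exp x ^ r) f0 + K 0 r (exp x ^ r) f1"
        unfolding d(3) by (intro K_add) auto
      also have "\<dots> \<le> C * exp x ^ k1 * N k1 f0 + C * exp x ^ k2 * N k2 f1"
        using k d by (intro add_mono le) auto
      also have "exp x ^ k2 = exp x ^ k1 * ?t"
        by (simp add: left_diff_distrib exp_diff flip: exp_of_nat_mult)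
      finally show "K 0 r (exp x ^ r) f / (C * exp x ^ k1) \<le> N k1 f0 + ?t * N k2 f1"
        using C by (simp add: pos_divide_le_eq algebra_simps)
    qed
    then have "K 0 r (exp (real r * x)) f \<le> C * (exp (real k1 * x) * K k1 k2 ?t f)"
      using C by (simp add: pos_divide_le_eq exp_of_nat_mult_power exp_of_nat2_mult ac_simps)
    then have "exp (- \<alpha> * x) * K 0 r (exp (real r * x)) f \<le> exp (- \<alpha> * x) * (C * (exp (real k1 * x) * K k1 k2 ?t f))"
      by (intro mult_left_mono) auto
    moreover have "exp (- (\<alpha> - real k1) * x) = exp (- \<alpha> * x) * exp (real k1 * x)"
      by (simp add: algebra_simps flip: exp_add)
    ultimately show "rescaled_K 0 r \<alpha> f x \<le> C * rescaled_K k1 k2 \<alpha> f x"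
      by (simp add: rescaled_K_def ac_simps)
  qed
qed

text \<open>The factor 2 works once the K-functional is positive, which for f \<noteq> 0 follows
  from the lower bound min 1 t * norm f.\<close>

lemma near_optimal_decomposition:
  assumes "0 < t"
  shows "\<exists>a b. f = a + b \<and> b \<in> E r \<and> norm a \<le> 2 * K 0 r t f \<and> t * N r b \<le> 2 * K 0 r t f"
proof (cases "f = 0")
  case True
  then show ?thesis using K_nonneg[of 0 0 t r] assms by (intro exI[of _ 0]) auto
next
  case False
  have "min 1 t * norm f \<le> K 0 r t f"
  proof (rule K_greatest)
    fix f0 f1 assume d: "f0 \<in> E 0" "f1 \<in> E r" "f = f0 + f1"
    have "min 1 t * norm f \<le> min 1 t * (norm f0 + norm f1)"
      unfolding d(3) using assms by (intro mult_left_mono norm_triangle_ineq) auto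
    also have "\<dots> \<le> 1 * norm f0 + t * N r f1"
      unfolding distrib_left using assms by (intro add_mono mult_mono norm_le_N) auto
    finally show "min 1 t * norm f \<le> N 0 f0 + t * N r f1" by simp
  qed simp
  moreover have "0 < min 1 t * norm f" using assms False by simp
  ultimately have "K 0 r t f < 2 * K 0 r t f" by linarith
  then obtain a b where "b \<in> E r" "f = a + b" "norm a + t * N r b < 2 * K 0 r t f"
    using K_approx[of f 0 r t "2 * K 0 r t f"] by (metis Ek_0 N_0)
  moreover have "0 \<le> t * N r b" using assms N_nonneg by simp
  ultimately show ?thesis using norm_ge_zero[of a] by (intro exI[of _ a] exI[of _ b]) linarith
qed

text \<open>With f = a y + b y nearly optimal at scale e^y, the increment \<open>d\<close> is both a
  difference of b's and of a's; the interpolation inequality thus bounds it in every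
  \<open>E k\<close>. Summing toward fine scales gives a x in E^k1, because \<alpha> > k1; toward
  coarse scales it gives b x with a bound in E^k2, because \<alpha> < k2.\<close>

lemma rescaled_K_le_convolution:
  assumes \<alpha>: "real k1 < \<alpha>" "\<alpha> < real k2" and r: "k2 \<le> r"
  defines "w \<equiv> exp (- min (\<alpha> - real k1) (real k2 - \<alpha>))"
  obtains C where "0 < C"
    "\<And>f M. (\<And>x. rescaled_K 0 r \<alpha> f x \<le> M) \<Longrightarrow> f \<in> E k1"
    "\<And>f M x. (\<And>x. rescaled_K 0 r \<alpha> f x \<le> M) \<Longrightarrow> rescaled_K k1 k2 \<alpha> f x \<le>
        C * ((\<Sum>n. w ^ n * rescaled_K 0 r \<alpha> f (x + (- real n))) + (\<Sum>n. w ^ n * rescaled_K 0 r \<alpha> f (x + real n)))"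
proof -
  obtain CJ where CJ: "CJ > 0" and J:
    "\<And>\<tau> k f. 0 < \<tau> \<Longrightarrow> k \<le> r \<Longrightarrow> f \<in> E r \<Longrightarrow> \<tau> ^ k * N k f \<le> CJ * (norm f + \<tau> ^ r * N r f)"
    using N_interpolation[of r] by blast
  \<comment> \<open>An increment costs 2 e^r + 2 in norm and 4 in E^r; e^r compares the K-functional
    at neighbouring scales.\<close>
  define C1 where "C1 = CJ * (2 * exp (real r) + 6)"
  have C1: "C1 > 0" unfolding C1_def using CJ by (intro mult_pos_pos) (auto intro: add_pos_pos)
  have w: "0 < w" "w < 1" using \<alpha> by (auto simp: w_def)
  have main: "f \<in> E k1 \<and> rescaled_K k1 k2 \<alpha> f x \<le> (C1 * exp (real k1)) *
      ((\<Sum>n. w ^ n * rescaled_K 0 r \<alpha> f (x + (- real n))) + (\<Sum>n. w ^ n * rescaled_K 0 r \<alpha> f (x + real n)))"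
    if bd: "\<And>x. rescaled_K 0 r \<alpha> f x \<le> M" for f M x
  proof -
    define \<kappa> where "\<kappa> y = K 0 r (exp (real r * y)) f" for y
    let ?F = "rescaled_K 0 r \<alpha> f"
    have \<kappa>F: "\<kappa> y = exp (\<alpha> * y) * ?F y" for y
      by (simp add: \<kappa>_def rescaled_K_def mult.assoc[symmetric] flip: exp_add)
    have F0: "0 \<le> ?F y" for y by (simp add: rescaled_K_nonneg)
    have \<kappa>0: "0 \<le> \<kappa> y" for y by (simp add: \<kappa>_def K_nonneg)
    have \<kappa>_norm: "\<kappa> y \<le> norm f" for y using K_le_N[of f 0] by (simp add: \<kappa>_def)
    have \<kappa>_mono: "\<kappa> y \<le> \<kappa> (y + 1)" for y
      unfolding \<kappa>_def by (rule K_mono) (auto intro!: mult_left_mono)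
    have \<kappa>_Suc: "\<kappa> (y + 1) \<le> exp (real r) * \<kappa> y" for y
      using K_mult_le[of f 0 "exp (real r * y)" "exp (real r)" r]
      by (simp add: \<kappa>_def distrib_left add.commute flip: exp_add)
    have "\<exists>a b. f = a + b \<and> b \<in> E r \<and> norm a \<le> 2 * \<kappa> y \<and> exp (real r * y) * N r b \<le> 2 * \<kappa> y" for y
      unfolding \<kappa>_def by (rule near_optimal_decomposition) simp
    then obtain a b where fab: "\<And>y. f = a y + b y" and bE: "\<And>y. b y \<in> E r"
      and a: "\<And>y. norm (a y) \<le> 2 * \<kappa> y" and b: "\<And>y. exp (real r * y) * N r (b y) \<le> 2 * \<kappa> y"
      by metis
    define d where "d y = b y - b (y + 1)" for y
    have d_a: "d y = a (y + 1) - a y" for y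
      using fab[of y] fab[of "y + 1"] by (simp add: d_def algebra_simps)
    have dE: "d y \<in> E r" for y unfolding d_def using Ek_diff[OF bE bE] by blast
    have dN: "exp (real k * y) * N k (d y) \<le> C1 * \<kappa> y" if k: "k \<le> r" for k y
    proof -
      have 1: "norm (d y) \<le> 2 * (exp (real r) * \<kappa> y) + 2 * \<kappa> y"
        unfolding d_a using norm_triangle_ineq4[of "a (y + 1)" "a y"] a[of y] a[of "y + 1"] \<kappa>_Suc[of y] by linarith
      have "exp (real r * y) * N r (b (y + 1)) = exp (- real r) * (exp (real r * (y + 1)) * N r (b (y + 1)))"
        by (simp add: distrib_left mult.assoc[symmetric] flip: exp_add)
      also have "\<dots> \<le> exp (- real r) * (2 * (exp (real r) * \<kappa> y))"
        using b[of "y + 1"] \<kappa>_Suc[of y] by (intro mult_left_mono) auto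
      also have "\<dots> = 2 * \<kappa> y"
        by (simp add: exp_minus)
      finally have b1: "exp (real r * y) * N r (b (y + 1)) \<le> 2 * \<kappa> y" .
      have "exp (real r * y) * N r (d y) \<le> exp (real r * y) * (N r (b y) + N r (b (y + 1)))"
        unfolding d_def using Ek_diff[OF bE[of y] bE[of "y + 1"]] by (intro mult_left_mono) auto
      then have 2: "exp (real r * y) * N r (d y) \<le> 4 * \<kappa> y"
        using b[of y] b1 by (simp add: distrib_left)
      have "exp (real k * y) * N k (d y) \<le> CJ * (norm (d y) + exp (real r * y) * N r (d y))"
        using J[of "exp y" k "d y"] k dE by (simp add: exp_of_nat_mult_power)
      also have "\<dots> \<le> CJ * ((2 * (exp (real r) * \<kappa> y) + 2 * \<kappa> y) + 4 * \<kappa> y)"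
        using 1 2 CJ by (intro mult_left_mono add_mono) auto
      also have "\<dots> = C1 * \<kappa> y" by (simp add: C1_def algebra_simps)
      finally show ?thesis .
    qed
    \<comment> \<open>\<open>w\<close> takes the slower of the two decay rates, so one kernel serves
      both sums.\<close>
    have wn: "exp (- (\<delta> * real n)) \<le> w ^ n" if "min (\<alpha> - real k1) (real k2 - \<alpha>) \<le> \<delta>" for \<delta> n
      using mult_left_mono[OF that, of "real n"] by (simp add: w_def mult.commute flip: exp_of_nat_mult)
    have sF: "summable (\<lambda>n. w ^ n * ?F (x + s n))" for s
      using powr_suminf_le(1)[of "\<lambda>n. w ^ n" "\<lambda>n. ?F (x + s n)" M 1] w F0 bd
      by (auto simp: summable_geometric suminf_geometric)
    have k1r: "k1 \<le> r" using \<alpha> r by simp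
    define S1 where "S1 = (\<Sum>n. w ^ n * ?F (x + (- real n)))"
    define S2 where "S2 = (\<Sum>n. w ^ n * ?F (x + real n))"
    define c1 where "c1 = C1 * exp (real k1) * exp ((\<alpha> - real k1) * x)"
    define c2 where "c2 = C1 * exp (- (real k2 - \<alpha>) * x)"
    have ax: "a x \<in> E k1" "N k1 (a x) \<le> c1 * S1"
    proof -
      \<comment> \<open>d y ends at a (y + 1), so the first increment must start at x - 1 for the
        sum to end at a x. This offset is the source of exp (real k1) in \<open>c1\<close>.\<close>
      define u where "u n = d (x - real n - 1)" for n
      have uE: "u n \<in> E k1" for n unfolding u_def using dE k1r by (rule Ek_antimono[rotated])
      have uN: "N k1 (u n) \<le> c1 * (w ^ n * ?F (x + (- real n)))" for n
      proof -
        let ?y = "x - real n"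
        have "exp (real k1 * (?y - 1)) * N k1 (u n) \<le> C1 * \<kappa> ?y"
          using dN[OF k1r, of "?y - 1"] mult_left_mono[OF \<kappa>_mono[of "?y - 1"] less_imp_le[OF C1]]
          by (simp add: u_def)
        then have "exp (- (real k1 * (?y - 1))) * (exp (real k1 * (?y - 1)) * N k1 (u n)) \<le>
            exp (- (real k1 * (?y - 1))) * (C1 * \<kappa> ?y)" by (intro mult_left_mono) auto
        then have "N k1 (u n) \<le> exp (- (real k1 * (?y - 1))) * (C1 * \<kappa> ?y)"
          by (simp add: mult.assoc[symmetric] flip: exp_add)
        also have "\<dots> = c1 * (exp (- ((\<alpha> - real k1) * real n)) * ?F ?y)"
        proof -
          have "exp (- (real k1 * (?y - 1))) * exp (\<alpha> * ?y) =
              exp (real k1) * exp ((\<alpha> - real k1) * x) * exp (- ((\<alpha> - real k1) * real n))"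
            by (simp add: algebra_simps flip: exp_add)
          then show ?thesis by (simp add: \<kappa>F c1_def mult_ac)
        qed
        also have "\<dots> \<le> c1 * (w ^ n * ?F ?y)"
          using C1 F0 by (intro mult_left_mono mult_right_mono wn) (auto simp: c1_def)
        finally show ?thesis by simp
      qed
      have sN: "summable (\<lambda>n. N k1 (u n))"
        by (rule summable_comparison_test'[OF summable_mult[OF sF[of "\<lambda>n. - real n"], of c1]])
          (use uN in \<open>simp add: N_nonneg\<close>)
      \<comment> \<open>The bound \<open>M\<close> yields \<kappa> y \<le> exp (\<alpha> y) M, which
        vanishes at fine scales because \<alpha> > 0.\<close>
      have "(\<lambda>n. a (x - real n)) \<longlonglongrightarrow> 0"
      proof (rule Lim_null_comparison[OF always_eventually, OF allI])
        fix n
        have "norm (a (x - real n)) \<le> 2 * (exp (\<alpha> * (x - real n)) * M)"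
          using order_trans[OF a[of "x - real n"], unfolded \<kappa>F] bd[of "x - real n"] by simp
        also have "\<dots> = 2 * exp (\<alpha> * x) * M * exp (- \<alpha>) ^ n"
          by (simp add: algebra_simps exp_diff exp_minus field_simps flip: exp_of_nat_mult exp_add)
        finally show "norm (a (x - real n)) \<le> 2 * exp (\<alpha> * x) * M * exp (- \<alpha>) ^ n" .
        show "(\<lambda>n. 2 * exp (\<alpha> * x) * M * exp (- \<alpha>) ^ n) \<longlonglongrightarrow> 0"
          using \<alpha> by (intro tendsto_mult_right_zero LIMSEQ_realpow_zero) auto
      qed
      from telescope_sums'[OF this] have "u sums a x"
        by (simp add: u_def[abs_def] d_a diff_diff_eq add.commute)
      then have "suminf u = a x" by (rule sums_unique[symmetric])
      moreover have "(\<Sum>n. N k1 (u n)) \<le> c1 * S1"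
        unfolding S1_def suminf_mult[OF sF, symmetric]
        by (intro suminf_le uN sN summable_mult sF)
      ultimately show "a x \<in> E k1" "N k1 (a x) \<le> c1 * S1"
        using Ek_suminf[OF uE sN] by auto
    qed
    have bx: "N k2 (b x) \<le> c2 * S2"
    proof -
      define u where "u n = d (x + real n)" for n
      have uE: "u n \<in> E k2" for n unfolding u_def using dE r by (rule Ek_antimono[rotated])
      have uN: "N k2 (u n) \<le> c2 * (w ^ n * ?F (x + real n))" for n
      proof -
        let ?y = "x + real n"
        have "exp (- (real k2 * ?y)) * (exp (real k2 * ?y) * N k2 (u n)) \<le> exp (- (real k2 * ?y)) * (C1 * \<kappa> ?y)"
          using dN[OF r, of ?y] by (intro mult_left_mono) (auto simp: u_def)
        then have "N k2 (u n) \<le> exp (- (real k2 * ?y)) * (C1 * \<kappa> ?y)"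
          by (simp add: mult.assoc[symmetric] flip: exp_add)
        also have "\<dots> = c2 * (exp (- ((real k2 - \<alpha>) * real n)) * ?F ?y)"
        proof -
          have "exp (- (real k2 * ?y)) * exp (\<alpha> * ?y) =
              exp (- (real k2 - \<alpha>) * x) * exp (- ((real k2 - \<alpha>) * real n))"
            by (simp add: algebra_simps flip: exp_add)
          then show ?thesis by (simp add: \<kappa>F c2_def mult_ac)
        qed
        also have "\<dots> \<le> c2 * (w ^ n * ?F ?y)"
          using C1 F0 by (intro mult_left_mono mult_right_mono wn) (auto simp: c2_def)
        finally show ?thesis .
      qed
      have sN: "summable (\<lambda>n. N k2 (u n))"
        by (rule summable_comparison_test'[OF summable_mult[OF sF[of real], of c2]])
          (use uN in \<open>simp add: N_nonneg\<close>)
      \<comment> \<open>Here \<kappa> \<le> norm f is enough: division by exp (real r * y) forces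
        decay at coarse scales.\<close>
      have "(\<lambda>n. b (x + real n)) \<longlonglongrightarrow> 0"
      proof (rule Lim_null_comparison[OF always_eventually, OF allI])
        fix n
        let ?y = "x + real n"
        have "exp (real r * ?y) * norm (b ?y) \<le> 2 * norm f"
          using b[of ?y] \<kappa>_norm[of ?y] mult_left_mono[OF norm_le_N[of "b ?y" r] exp_ge_zero[of "real r * ?y"]]
          by linarith
        then have "exp (- (real r * ?y)) * (exp (real r * ?y) * norm (b ?y)) \<le> exp (- (real r * ?y)) * (2 * norm f)"
          by (intro mult_left_mono) auto
        then have "norm (b ?y) \<le> exp (- (real r * ?y)) * (2 * norm f)"
          by (simp add: mult.assoc[symmetric] flip: exp_add)
        also have "exp (- (real r * ?y)) = exp (- (real r * x)) * exp (- real r) ^ n"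
          by (simp add: algebra_simps flip: exp_of_nat_mult exp_add)
        finally show "norm (b ?y) \<le> exp (- (real r * x)) * exp (- real r) ^ n * (2 * norm f)" .
        have "exp (- real r) < 1" using \<alpha> r by simp
        then show "(\<lambda>n. exp (- (real r * x)) * exp (- real r) ^ n * (2 * norm f)) \<longlonglongrightarrow> 0"
          by (intro tendsto_mult_left_zero tendsto_mult_right_zero LIMSEQ_realpow_zero) auto
      qed
      from telescope_sums'[OF this] have "u sums b x"
        by (simp add: u_def[abs_def] d_def add_ac)
      then have "suminf u = b x" by (rule sums_unique[symmetric])
      moreover have "(\<Sum>n. N k2 (u n)) \<le> c2 * S2"
        unfolding S2_def suminf_mult[OF sF, symmetric]
        by (intro suminf_le uN sN summable_mult sF)
      ultimately show ?thesis using Ek_suminf[OF uE sN] by auto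
    qed
    have bE1: "b x \<in> E k1" and bE2: "b x \<in> E k2"
      using Ek_antimono[OF k1r bE] Ek_antimono[OF r bE] by auto
    have S2: "0 \<le> S2" unfolding S2_def using w F0 by (intro suminf_nonneg sF) auto
    have "f \<in> E k1" using Ek_add[OF ax(1) bE1] fab[of x] by simp
    moreover have "rescaled_K k1 k2 \<alpha> f x \<le> C1 * exp (real k1) * (S1 + S2)"
    proof -
      let ?t = "exp ((real k2 - real k1) * x)" and ?e = "exp (- (\<alpha> - real k1) * x)"
      have "K k1 k2 ?t f \<le> N k1 (a x) + ?t * N k2 (b x)"
        using K_le[OF ax(1) bE2, of ?t] fab[of x] by simp
      also have "\<dots> \<le> c1 * S1 + ?t * (c2 * S2)"
        using ax bx by (intro add_mono mult_left_mono) auto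
      finally have "?e * K k1 k2 ?t f \<le> ?e * (c1 * S1 + ?t * (c2 * S2))"
        by (intro mult_left_mono) auto
      also have "\<dots> = (?e * c1) * S1 + (?e * ?t * c2) * S2"
        by (simp add: algebra_simps)
      also have "?e * c1 = C1 * exp (real k1)"
      proof -
        have "?e * exp ((\<alpha> - real k1) * x) = 1" by (simp add: algebra_simps flip: exp_add)
        then show ?thesis by (simp add: c1_def mult_ac)
      qed
      \<comment> \<open>The exponents -(\<alpha> - k1), k2 - k1 and -(k2 - \<alpha>) add up to 0, so
        the constant does not depend on x.\<close>
      also have "?e * ?t * c2 = C1"
      proof -
        have "?e * ?t * exp (- (real k2 - \<alpha>) * x) = 1" by (simp add: algebra_simps flip: exp_add)
        then show ?thesis by (simp add: c2_def mult_ac)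
      qed
      also have "C1 * exp (real k1) * S1 + C1 * S2 \<le> C1 * exp (real k1) * S1 + (C1 * exp (real k1)) * S2"
        using C1 S2 by (intro add_left_mono mult_right_mono) auto
      finally show ?thesis by (simp add: rescaled_K_def distrib_left)
    qed
    ultimately show ?thesis by (simp add: S1_def S2_def)
  qed
  show ?thesis
    by (rule that[of "C1 * exp (real k1)"]) (use main C1 in auto)
qed

end

theorem mainTheorem4:
  fixes T :: "real \<times> real \<Rightarrow> 'a::banach \<Rightarrow> 'a"
    and r k1 k2 :: nat and \<alpha> :: real and q :: ereal
  assumes "contraction_rep T"
    and "1 \<le> q"
    and "real k1 < \<alpha>" and "\<alpha> < real k2" and "k2 \<le> r"
  shows "interp_space T 0 r (\<alpha> / real r) q
           = interp_space T k1 k2 ((\<alpha> - real k1) / (real k2 - real k1)) q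
       \<and> (\<exists>C>0. \<forall>f\<in>interp_space T 0 r (\<alpha> / real r) q.
             interp_norm T 0 r (\<alpha> / real r) q f
               \<le> ennreal C * interp_norm T k1 k2 ((\<alpha> - real k1) / (real k2 - real k1)) q f
           \<and> interp_norm T k1 k2 ((\<alpha> - real k1) / (real k2 - real k1)) q f
               \<le> ennreal C * interp_norm T 0 r (\<alpha> / real r) q f)"
proof -
  interpret axb_rep T by unfold_locales fact
  have k: "k1 < k2" "k1 \<le> k2" "0 < r" using assms(3-5) by auto
  let ?n0 = "interp_norm T 0 r (\<alpha> / real r) q"
  let ?n1 = "interp_norm T k1 k2 ((\<alpha> - real k1) / (real k2 - real k1)) q"
  let ?F = "rescaled_K 0 r \<alpha>" and ?G = "rescaled_K k1 k2 \<alpha>" and ?m = "real k2 - real k1"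
  have m: "0 < ?m" "0 < real r" using k by auto
  have n0: "?n0 f = Lq_norm (real r) q (?F f)" for f
    using interp_norm_eq_Lq_norm[of f 0 r \<alpha> q] k by simp
  have n1: "?n1 f = Lq_norm ?m q (?G f)" if "f \<in> E k1" for f
    using interp_norm_eq_Lq_norm[of f k1 k2 \<alpha> q] k that by simp
  obtain c where c: "0 < c" "\<And>f x. f \<in> E k1 \<Longrightarrow> ?F f x \<le> c * ?G f x"
    using rescaled_K_0_le[OF k(2) assms(5), of \<alpha>] by blast
  obtain C where C: "0 < C" and "\<And>F G. F \<in> borel_measurable borel \<Longrightarrow> (\<And>x. 0 \<le> F x) \<Longrightarrow> (\<And>x. 0 \<le> G x) \<Longrightarrow>
       (\<And>x. G x \<le> c * F x) \<Longrightarrow> Lq_norm (real r) q G \<le> ennreal C * Lq_norm ?m q F"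
    using Lq_norm_mono_const[OF m assms(2) c(1)] by blast
  then have le0: "?n0 f \<le> ennreal C * ?n1 f" if "f \<in> E k1" for f
    using c(2) that by (simp add: n0 n1 rescaled_K_measurable rescaled_K_nonneg)
  define w where "w = exp (- min (\<alpha> - real k1) (real k2 - \<alpha>))"
  have w: "0 < w" "w < 1" using assms(3,4) by (auto simp: w_def)
  obtain d where d: "0 < d" "\<And>f M. (\<And>x. ?F f x \<le> M) \<Longrightarrow> f \<in> E k1"
    "\<And>f M x. (\<And>x. ?F f x \<le> M) \<Longrightarrow> ?G f x \<le> d * ((\<Sum>n. w ^ n * ?F f (x + (- real n))) + (\<Sum>n. w ^ n * ?F f (x + real n)))"
    using rescaled_K_le_convolution[OF assms(3-5)] unfolding w_def by blast
  obtain D where D: "0 < D" and D': "\<And>F G M. F \<in> borel_measurable borel \<Longrightarrow> (\<And>x. 0 \<le> F x) \<Longrightarrow> (\<And>x. F x \<le> M) \<Longrightarrow> (\<And>x. 0 \<le> G x) \<Longrightarrow>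
       (\<And>x. G x \<le> d * ((\<Sum>n. w ^ n * F (x + (- real n))) + (\<Sum>n. w ^ n * F (x + real n)))) \<Longrightarrow>
       Lq_norm ?m q G \<le> ennreal D * Lq_norm (real r) q F"
    using Lq_norm_convolution_le[OF m(2,1) assms(2) d(1) w] by blast
  \<comment> \<open>Finiteness is first turned into a pointwise bound \<open>M\<close>. Only then do
    the series converge and give membership in \<open>E k1\<close>, without which the other norm
    could not be rewritten as an \<open>Lq_norm\<close>.\<close>
  have le1: "f \<in> E k1 \<and> ?n1 f \<le> ennreal D * ?n0 f" if fin: "?n0 f < \<infinity>" for f
  proof -
    obtain M where M: "\<And>x. ?F f x \<le> M"
      using rescaled_K_bounded[of f 0 \<alpha> r "real r" q] fin[unfolded n0] m assms by auto
    have f: "f \<in> E k1" using d(2)[OF M] .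
    then show ?thesis
      using D'[of "?F f" M "?G f", OF _ _ M _ d(3)[OF M]]
      by (simp add: n0 n1 rescaled_K_measurable rescaled_K_nonneg)
  qed
  have fin: "ennreal C' * x < \<infinity>" if "x < \<infinity>" for C' x
    using that by (simp add: ennreal_mult_less_top)
  have "interp_space T 0 r (\<alpha> / real r) q = interp_space T k1 k2 ((\<alpha> - real k1) / ?m) q"
  proof (intro subset_antisym subsetI)
    fix f assume "f \<in> interp_space T 0 r (\<alpha> / real r) q"
    then have "?n0 f < \<infinity>" by (simp add: interp_space_def)
    then show "f \<in> interp_space T k1 k2 ((\<alpha> - real k1) / ?m) q"
      using le1[of f] le_less_trans[OF _ fin[of "?n0 f" D]] by (simp add: interp_space_def)
  next
    fix f assume "f \<in> interp_space T k1 k2 ((\<alpha> - real k1) / ?m) q"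
    then have "f \<in> E k1" "?n1 f < \<infinity>" by (auto simp: interp_space_def)
    then show "f \<in> interp_space T 0 r (\<alpha> / real r) q"
      using le_less_trans[OF le0 fin] by (simp add: interp_space_def)
  qed
  moreover have "\<exists>C>0. \<forall>f\<in>interp_space T 0 r (\<alpha> / real r) q. ?n0 f \<le> ennreal C * ?n1 f \<and> ?n1 f \<le> ennreal C * ?n0 f"
  proof (intro exI[of _ "max C D"] conjI ballI)
    show "0 < max C D" using C by simp
    fix f assume "f \<in> interp_space T 0 r (\<alpha> / real r) q"
    then have f: "f \<in> E k1" "?n1 f \<le> ennreal D * ?n0 f" using le1 by (auto simp: interp_space_def)
    show "?n0 f \<le> ennreal (max C D) * ?n1 f"
      using le0[OF f(1)] by (rule order_trans) (auto intro!: mult_right_mono ennreal_leI)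
    show "?n1 f \<le> ennreal (max C D) * ?n0 f"
      using f(2) by (rule order_trans) (auto intro!: mult_right_mono ennreal_leI)
  qed
  ultimately show ?thesis by blast
qed

end
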